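(* Let $G$ be an $N$-graph with assigned angles, and let the ambient space be $\mathbb R^2$. Then a network $\mathcal N=(G,\Gamma)$ is V-degenerate (degenerate in the sense of virtual tangents) if and only if it is P-degenerate (degenerate in the sense of paths).
   Context: Let $I_i=[0,1]\times\{i\}$ for $i=1,\dots,N$, $E=\bigcup_i I_i$, $V=\bigcup_i\{0,1\}\times\{i\}$. An $N$-graph is a topological quotient $G=E/\sim$, where $\sim$ identifies points of $V$ only; $\pi:E\to G$ is the projection, $E_i=\pi(I_i)$ the edges, $V_G=\pi(V)$ the vertices. For $p\in V_G$, $\pi^{-1}(p)$ is a finite set of pairs $(z,i)\in\{0,1\}\times\{1,\dots,N\}$. A subgraph is the union of a (possibly empty) collection of edges with the same identifications. $G$ has assigned angles if a unit vector $d^{z,i}\in\mathbb S^1$ is given for each $(z,i)\in\{0,1\}\times\{1,\dots,N\}$; subgraphs inherit the assignment. A network is a pair $\mathcal N=(G,\Gamma)$ with $\Gamma:G\to\mathbb R^2$ continuous such that each $\gamma^i=\Gamma|_{E_i}$ (viewed as a map on $[0,1]$) is either constant (singular curve) or an immersion of class $H^2$ (regular curve). $\mathrm{Sing}(\mathcal N)$ is the subgraph formed by the edges carrying singular curves, and $\mathrm{Reg}(\mathcal N)$ the one formed by the edges carrying regular curves. For a regular curve, the (real) outer tangents are $\tau^{z,i}=(-1)^z\dot\gamma^i(z)/|\dot\gamma^i(z)|$, $z\in\{0,1\}$. Angle condition in terms of virtual tangents: for every singular curve $\gamma^i$ there exist unit vectors $\tau^{0,i}=-\tau^{1,i}$ (virtual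 tangents) such that for every $p\in V_G$ there is a rotation $\mathrm R_p$ of $\mathbb R^2$ with $\tau^{z,i}=\mathrm R_p(d^{z,i})$ for all $(z,i)\in\pi^{-1}(p)$, where $\tau^{z,i}$ is the real outer tangent if $\gamma^i$ is regular and the virtual one if $\gamma^i$ is singular. V-degenerate: a subgraph $H\subseteq G$ is V-stratified straight if there are subgraphs $\emptyset=H_q\subset\dots\subset H_1\subset H_0=H$ and maps $\Sigma_j:H_j\to\mathbb R^2$ such that for $j=0,\dots,q-1$ the network $(H_j,\Sigma_j)$ satisfies the angle condition in terms of virtual tangents, with (real or virtual) tangents coinciding with those associated with $(H_0,\Sigma_0)$, its regular curves are straight segments, and $H_{j+1}=\mathrm{Sing}((H_j,\Sigma_j))$. $\mathcal N=(G,\Gamma)$ is V-degenerate if it satisfies the angle condition in terms of virtual tangents with some (real or virtual) tangents $\tau^{z,i}$, and $\mathrm{Sing}(\mathcal N)$ is V-stratified straight with (real or virtual) tangents coinciding with these $\tau^{z,i}$. Angles: for nonzero planar vectors $a,b$, $\angle a,b\in\mathbb R/2\pi\mathbb Z$ is the counterclockwise angle from $a$ to $b$. Paths: a path composed of $\mathcal J$ edges is a sequence $\mathcal P(j)=(z_j,i_j)\in\{0,1\}\times\{1,\dots,N\}$, $j=1,\dots,\mathcal J$, with $\pi(1-z_j,i_j)=\pi(z_{j+1},i_{j+1})$ for $1\le j\le\mathcal J-1$. It is a cycle if moreover $\pi(1-z_{\mathcal J},i_{\mathcal J})=\pi(z_1,i_1)$. A path that is not a cycle is called an open path. The angle of a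 path is, modulo $2\pi$, $\Theta(\mathcal P)=\sum_{j=1}^{\mathcal J-1}\angle(-d^{1-z_j,i_j}),d^{z_{j+1},i_{j+1}}$ if $\mathcal P$ is an open path, and $\Theta(\mathcal P)=\sum_{j=1}^{\mathcal J}\angle(-d^{1-z_j,i_j}),d^{z_{j+1},i_{j+1}}$ (indices modulo $\mathcal J$) if $\mathcal P$ is a cycle. Angle condition in terms of paths: (i) the regular curves satisfy the angle condition: for every $p\in V_G$ there is a rotation $\mathrm R_p$ with $\tau^{z,i}=\mathrm R_p(d^{z,i})$ for all $(z,i)\in\pi^{-1}(p)$ such that $\gamma^i$ is regular; (ii) for every cycle $\mathcal P$ all of whose edges $E_{i_j}$, $j=1,\dots,\mathcal J$, are in $\mathrm{Sing}(\mathcal N)$, one has $\Theta(\mathcal P)=0$ mod $2\pi$; (iii) for every open path $\mathcal P$ composed of $\mathcal J\ge2$ edges such that $E_{i_j}$ is in $\mathrm{Sing}(\mathcal N)$ for $2\le j\le\mathcal J-1$ and $E_{i_1},E_{i_{\mathcal J}}$ are in $\mathrm{Reg}(\mathcal N)$, one has $\Theta(\mathcal P)=\angle(-\tau^{1-z_1,i_1}),\tau^{z_{\mathcal J},i_{\mathcal J}}$ mod $2\pi$. P-degenerate: a subgraph $H\subseteq G$ is P-stratified straight if there are subgraphs $\emptyset=H_q\subset\dots\subset H_1\subset H_0=H$ and maps $\Sigma_j:H_j\to\mathbb R^2$ such that for $j=0,\dots,q-1$, $(H_j,\Sigma_j)$ is a (possibly singular) network satisfying the angle condition in terms of paths whose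 curves are (possibly degenerate, i.e. constant) straight segments, and $H_{j+1}=\mathrm{Sing}((H_j,\Sigma_j))$. $\mathcal N=(G,\Gamma)$ is P-degenerate if it satisfies the angle condition in terms of paths and $\mathrm{Sing}(\mathcal N)$ is P-stratified straight.
   Formalization: In the angle condition in terms of paths, clause (iii) is imposed on all such paths with at least 2 edges, also those ending at their starting vertex (using the open-path angle); with open paths only, the equivalence fails, e.g. for a triangle with one singular edge. *)

theory Defs
  imports "HOL-Analysis.Analysis" "HOL-Library.Real_Mod"
begin

section \<open>Graphs\<close>

definition edge_space :: "nat \<Rightarrow> (real \<times> nat) set" where
  "edge_space N = {0..1} \<times> {1..N}"

definition endpoints :: "nat \<Rightarrow> (real \<times> nat) set" where
  "endpoints N = {0, 1} \<times> {1..N}"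

text \<open>An \<open>N\<close>-graph is given by the equivalence relation \<open>r\<close> on the disjoint union of the intervals.\<close>

definition N_graph :: "nat \<Rightarrow> (real \<times> nat) rel \<Rightarrow> bool" where
  "N_graph N r \<longleftrightarrow> equiv (edge_space N) r \<and>
     (\<forall>(x, y) \<in> r. x \<noteq> y \<longrightarrow> x \<in> endpoints N \<and> y \<in> endpoints N)"

text \<open>The points of the graph are the equivalence classes.\<close>

definition proj :: "(real \<times> nat) rel \<Rightarrow> real \<times> nat \<Rightarrow> (real \<times> nat) set" where
  "proj r x = r `` {x}"

definition graph_topology :: "nat \<Rightarrow> (real \<times> nat) rel \<Rightarrow> (real \<times> nat) set topology" where
  "graph_topology N r = topology (\<lambda>U. U \<subseteq> edge_space N // r \<and>
     openin (top_of_set (edge_space N)) {x \<in> edge_space N. proj r x \<in> U})"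

lemma openin_graph_topology:
  "openin (graph_topology N r) U \<longleftrightarrow> U \<subseteq> edge_space N // r \<and>
     openin (top_of_set (edge_space N)) {x \<in> edge_space N. proj r x \<in> U}"
proof -
  let ?P = "\<lambda>U. U \<subseteq> edge_space N // r \<and>
     openin (top_of_set (edge_space N)) {x \<in> edge_space N. proj r x \<in> U}"
  have "istopology ?P"
    unfolding istopology_def
  proof (intro conjI allI impI)
    fix S T assume "?P S" "?P T"
    moreover have "{x \<in> edge_space N. proj r x \<in> S \<inter> T} =
      {x \<in> edge_space N. proj r x \<in> S} \<inter> {x \<in> edge_space N. proj r x \<in> T}" by auto
    ultimately show "S \<inter> T \<subseteq> edge_space N // r"
      "openin (top_of_set (edge_space N)) {x \<in> edge_space N. proj r x \<in> S \<inter> T}"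
      by (auto intro: openin_Int)
  next
    fix K assume K: "\<forall>S\<in>K. ?P S"
    have "{x \<in> edge_space N. proj r x \<in> \<Union>K} =
      (\<Union>S\<in>K. {x \<in> edge_space N. proj r x \<in> S})" by auto
    then show "\<Union>K \<subseteq> edge_space N // r"
      "openin (top_of_set (edge_space N)) {x \<in> edge_space N. proj r x \<in> \<Union>K}"
      using K by auto
  qed
  then show ?thesis
    by (simp add: graph_topology_def topology_inverse')
qed

lemma quotient_map_proj:
  "quotient_map (top_of_set (edge_space N)) (graph_topology N r) (proj r)"
proof -
  have img: "proj r ` edge_space N = edge_space N // r"
    by (auto simp: proj_def quotient_def)
  have "openin (graph_topology N r) (edge_space N // r)"
  proof -
    have "{x \<in> edge_space N. proj r x \<in> edge_space N // r} = edge_space N"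
      using img by auto
    then show ?thesis by (simp add: openin_graph_topology)
  qed
  then have "topspace (graph_topology N r) = edge_space N // r"
    by (meson openin_graph_topology openin_subset openin_topspace subset_antisym)
  then show ?thesis
    by (simp add: quotient_map_def img openin_graph_topology)
qed

text \<open>
  A subgraph is represented by the set \<open>S \<subseteq> {1..N}\<close> of the indices of its edges; its points are
  those of \<open>subgraph_points r S\<close>, with the topology induced by the whole graph. The whole graph is
  the case \<open>S = {1..N}\<close>.
\<close>

definition edge :: "(real \<times> nat) rel \<Rightarrow> nat \<Rightarrow> (real \<times> nat) set set" where
  "edge r i = proj r ` ({0..1} \<times> {i})"

definition subgraph_points :: "(real \<times> nat) rel \<Rightarrow> nat set \<Rightarrow> (real \<times> nat) set set" where
  "subgraph_points r S = (\<Union>i\<in>S. edge r i)"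

text \<open>The endpoint \<open>z \<in> {0, 1}\<close> of the edge \<open>i\<close>, as a point of the graph.\<close>

definition vertex :: "(real \<times> nat) rel \<Rightarrow> nat \<Rightarrow> nat \<Rightarrow> (real \<times> nat) set" where
  "vertex r z i = proj r (real z, i)"

definition vertices :: "(real \<times> nat) rel \<Rightarrow> nat set \<Rightarrow> (real \<times> nat) set set" where
  "vertices r S = {vertex r z i | z i. z \<in> {0, 1} \<and> i \<in> S}"

definition assigned_angles :: "nat \<Rightarrow> (nat \<Rightarrow> nat \<Rightarrow> real^2) \<Rightarrow> bool" where
  "assigned_angles N d \<longleftrightarrow> (\<forall>z\<in>{0, 1}. \<forall>i\<in>{1..N}. norm (d z i) = 1)"


section \<open>Curves of class \<open>H\<^sup>2\<close>\<close>

definition test_function :: "(real \<Rightarrow> real) \<Rightarrow> bool" where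
  "test_function \<phi> \<longleftrightarrow> (\<forall>n x. (deriv ^^ n) \<phi> field_differentiable (at x)) \<and>
     closure {x. \<phi> x \<noteq> 0} \<subseteq> {0<..<1}"

definition square_integrable :: "(real \<Rightarrow> real^2) \<Rightarrow> bool" where
  "square_integrable f \<longleftrightarrow> set_borel_measurable lebesgue {0<..<1} f \<and>
     set_integrable lebesgue {0<..<1} (\<lambda>t. (norm (f t))\<^sup>2)"

definition weak_derivative :: "(real \<Rightarrow> real^2) \<Rightarrow> (real \<Rightarrow> real^2) \<Rightarrow> bool" where
  "weak_derivative f g \<longleftrightarrow> (\<forall>\<phi>. test_function \<phi> \<longrightarrow>
     (LINT t:{0<..<1}|lebesgue. deriv \<phi> t *\<^sub>R f t) =
     - (LINT t:{0<..<1}|lebesgue. \<phi> t *\<^sub>R g t))"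

definition class_H2 :: "(real \<Rightarrow> real^2) \<Rightarrow> bool" where
  "class_H2 f \<longleftrightarrow> (\<exists>g h. square_integrable f \<and> square_integrable g \<and> square_integrable h \<and>
     weak_derivative f g \<and> weak_derivative g h)"

text \<open>Only the values on \<open>[0,1]\<close> matter, so that the derivatives at 0 and 1 are one-sided.\<close>

abbreviation velocity :: "(real \<Rightarrow> real^2) \<Rightarrow> real \<Rightarrow> real^2" where
  "velocity \<gamma> t \<equiv> vector_derivative \<gamma> (at t within {0..1})"

definition immersion :: "(real \<Rightarrow> real^2) \<Rightarrow> bool" where
  "immersion \<gamma> \<longleftrightarrow> (\<forall>t\<in>{0..1}. \<gamma> differentiable (at t within {0..1}) \<and> velocity \<gamma> t \<noteq> 0) \<and>
     continuous_on {0..1} (velocity \<gamma>)"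

definition regular_curve :: "(real \<Rightarrow> real^2) \<Rightarrow> bool" where
  "regular_curve \<gamma> \<longleftrightarrow> immersion \<gamma> \<and> class_H2 \<gamma>"

definition singular_curve :: "(real \<Rightarrow> real^2) \<Rightarrow> bool" where
  "singular_curve \<gamma> \<longleftrightarrow> \<gamma> constant_on {0..1}"

text \<open>A constant curve is a degenerate segment; an immersion cannot traverse a segment
  back and forth.\<close>

definition straight_segment :: "(real \<Rightarrow> real^2) \<Rightarrow> bool" where
  "straight_segment \<gamma> \<longleftrightarrow> \<gamma> ` {0..1} = closed_segment (\<gamma> 0) (\<gamma> 1)"


section \<open>Networks\<close>

type_synonym graph_map = "(real \<times> nat) set \<Rightarrow> real^2"

definition curve :: "(real \<times> nat) rel \<Rightarrow> graph_map \<Rightarrow> nat \<Rightarrow> real \<Rightarrow> real^2" where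
  "curve r \<Gamma> i t = \<Gamma> (proj r (t, i))"

definition network :: "nat \<Rightarrow> (real \<times> nat) rel \<Rightarrow> nat set \<Rightarrow> graph_map \<Rightarrow> bool" where
  "network N r S \<Gamma> \<longleftrightarrow> S \<subseteq> {1..N} \<and>
     continuous_map (subtopology (graph_topology N r) (subgraph_points r S)) euclidean \<Gamma> \<and>
     (\<forall>i\<in>S. singular_curve (curve r \<Gamma> i) \<or> regular_curve (curve r \<Gamma> i))"

definition Sing :: "(real \<times> nat) rel \<Rightarrow> nat set \<Rightarrow> graph_map \<Rightarrow> nat set" where
  "Sing r S \<Gamma> = {i \<in> S. singular_curve (curve r \<Gamma> i)}"

definition Reg :: "(real \<times> nat) rel \<Rightarrow> nat set \<Rightarrow> graph_map \<Rightarrow> nat set" where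
  "Reg r S \<Gamma> = {i \<in> S. regular_curve (curve r \<Gamma> i)}"

definition outer_tangent :: "(real \<times> nat) rel \<Rightarrow> graph_map \<Rightarrow> nat \<Rightarrow> nat \<Rightarrow> real^2" where
  "outer_tangent r \<Gamma> z i =
     ((-1) ^ z / norm (velocity (curve r \<Gamma> i) (real z))) *\<^sub>R velocity (curve r \<Gamma> i) (real z)"


section \<open>Degeneracy in the sense of virtual tangents\<close>

text \<open>\<open>\<tau>\<close> collects the real outer tangents of the regular curves and the virtual tangents of the
  singular ones.\<close>

definition virtual_angle_condition ::
  "(real \<times> nat) rel \<Rightarrow> (nat \<Rightarrow> nat \<Rightarrow> real^2) \<Rightarrow> nat set \<Rightarrow> graph_map \<Rightarrow>
     (nat \<Rightarrow> nat \<Rightarrow> real^2) \<Rightarrow> bool" where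
  "virtual_angle_condition r d S \<Gamma> \<tau> \<longleftrightarrow>
     (\<forall>i\<in>Reg r S \<Gamma>. \<forall>z\<in>{0, 1}. \<tau> z i = outer_tangent r \<Gamma> z i) \<and>
     (\<forall>i\<in>Sing r S \<Gamma>. norm (\<tau> 0 i) = 1 \<and> norm (\<tau> 1 i) = 1 \<and> \<tau> 0 i = - \<tau> 1 i) \<and>
     (\<forall>p\<in>vertices r S. \<exists>R :: real^2^2. rotation_matrix R \<and>
        (\<forall>z\<in>{0, 1}. \<forall>i\<in>S. vertex r z i = p \<longrightarrow> \<tau> z i = R *v d z i))"

text \<open>The requirement that the tangents of all strata coincide is expressed by the single
  family \<open>\<tau>\<close>.\<close>

definition V_stratified_straight ::
  "nat \<Rightarrow> (real \<times> nat) rel \<Rightarrow> (nat \<Rightarrow> nat \<Rightarrow> real^2) \<Rightarrow> nat set \<Rightarrow>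
     (nat \<Rightarrow> nat \<Rightarrow> real^2) \<Rightarrow> bool" where
  "V_stratified_straight N r d S \<tau> \<longleftrightarrow> S \<subseteq> {1..N} \<and>
     (\<exists>(q :: nat) (H :: nat \<Rightarrow> nat set) (\<Sigma> :: nat \<Rightarrow> graph_map).
        H 0 = S \<and> H q = {} \<and> (\<forall>j<q. H (Suc j) \<subset> H j) \<and>
        (\<forall>j<q. network N r (H j) (\<Sigma> j) \<and>
           virtual_angle_condition r d (H j) (\<Sigma> j) \<tau> \<and>
           (\<forall>i\<in>Reg r (H j) (\<Sigma> j). straight_segment (curve r (\<Sigma> j) i)) \<and>
           H (Suc j) = Sing r (H j) (\<Sigma> j)))"

definition V_degenerate ::
  "nat \<Rightarrow> (real \<times> nat) rel \<Rightarrow> (nat \<Rightarrow> nat \<Rightarrow> real^2) \<Rightarrow> graph_map \<Rightarrow> bool" where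
  "V_degenerate N r d \<Gamma> \<longleftrightarrow>
     (\<exists>\<tau>. virtual_angle_condition r d {1..N} \<Gamma> \<tau> \<and>
        V_stratified_straight N r d (Sing r {1..N} \<Gamma>) \<tau>)"


section \<open>Degeneracy in the sense of paths\<close>

text \<open>Elements of \<open>\<real>/2\<pi>\<int>\<close> are represented by real numbers and compared with
  \<open>[_ = _] (rmod 2 * pi)\<close>.\<close>

definition to_complex :: "real^2 \<Rightarrow> complex" where
  "to_complex v = Complex (v $ 1) (v $ 2)"

definition ccw_angle :: "real^2 \<Rightarrow> real^2 \<Rightarrow> real" where
  "ccw_angle a b = Arg (to_complex b / to_complex a)"

text \<open>A path composed of \<open>J\<close> edges is a sequence \<open>P 1, \<dots>, P J\<close> of pairs \<open>(z, i)\<close>: the edge \<open>i\<close> is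
  traversed from its endpoint \<open>z\<close> to its endpoint \<open>1 - z\<close>.\<close>

definition start_vertex :: "(real \<times> nat) rel \<Rightarrow> nat \<times> nat \<Rightarrow> (real \<times> nat) set" where
  "start_vertex r = (\<lambda>(z, i). vertex r z i)"

definition end_vertex :: "(real \<times> nat) rel \<Rightarrow> nat \<times> nat \<Rightarrow> (real \<times> nat) set" where
  "end_vertex r = (\<lambda>(z, i). vertex r (1 - z) i)"

definition is_path :: "(real \<times> nat) rel \<Rightarrow> nat set \<Rightarrow> nat \<Rightarrow> (nat \<Rightarrow> nat \<times> nat) \<Rightarrow> bool" where
  "is_path r S J P \<longleftrightarrow> 1 \<le> J \<and> (\<forall>j\<in>{1..J}. P j \<in> {0, 1} \<times> S) \<and>
     (\<forall>j\<in>{1..<J}. end_vertex r (P j) = start_vertex r (P (j + 1)))"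

definition is_cycle :: "(real \<times> nat) rel \<Rightarrow> nat set \<Rightarrow> nat \<Rightarrow> (nat \<Rightarrow> nat \<times> nat) \<Rightarrow> bool" where
  "is_cycle r S J P \<longleftrightarrow> is_path r S J P \<and> end_vertex r (P J) = start_vertex r (P 1)"

definition turning_angle :: "(nat \<Rightarrow> nat \<Rightarrow> real^2) \<Rightarrow> nat \<times> nat \<Rightarrow> nat \<times> nat \<Rightarrow> real" where
  "turning_angle d = (\<lambda>(z, i) (z', i'). ccw_angle (- d (1 - z) i) (d z' i'))"

definition open_angle :: "(nat \<Rightarrow> nat \<Rightarrow> real^2) \<Rightarrow> nat \<Rightarrow> (nat \<Rightarrow> nat \<times> nat) \<Rightarrow> real" where
  "open_angle d J P = (\<Sum>j\<in>{1..<J}. turning_angle d (P j) (P (j + 1)))"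

definition cycle_angle :: "(nat \<Rightarrow> nat \<Rightarrow> real^2) \<Rightarrow> nat \<Rightarrow> (nat \<Rightarrow> nat \<times> nat) \<Rightarrow> real" where
  "cycle_angle d J P = open_angle d J P + turning_angle d (P J) (P 1)"

text \<open>
  The last clause concerns all the paths that join two regular edges through singular ones, read
  as open paths: no angle is taken between the last edge and the first one. It includes the paths
  that happen to end at the vertex from which they start. They cannot be left out: consider a
  triangle with vertices \<open>p, q, s\<close> whose edge \<open>q s\<close> is singular and whose edges \<open>p q\<close> and \<open>s p\<close>
  are regular. Every path that joins these two regular edges through \<open>q s\<close> starts and ends at \<open>p\<close>,
  and the virtual tangents of \<open>q s\<close> are constrained at both of its endpoints.
\<close>

definition path_angle_condition ::
  "(real \<times> nat) rel \<Rightarrow> (nat \<Rightarrow> nat \<Rightarrow> real^2) \<Rightarrow> nat set \<Rightarrow> graph_map \<Rightarrow> bool" where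
  "path_angle_condition r d S \<Gamma> \<longleftrightarrow>
     (\<forall>p\<in>vertices r S. \<exists>R :: real^2^2. rotation_matrix R \<and>
        (\<forall>z\<in>{0, 1}. \<forall>i\<in>Reg r S \<Gamma>.
           vertex r z i = p \<longrightarrow> outer_tangent r \<Gamma> z i = R *v d z i)) \<and>
     (\<forall>J P. is_cycle r S J P \<and> (\<forall>j\<in>{1..J}. snd (P j) \<in> Sing r S \<Gamma>) \<longrightarrow>
        [cycle_angle d J P = 0] (rmod (2 * pi))) \<and>
     (\<forall>J P. is_path r S J P \<and> 2 \<le> J \<and>
        snd (P 1) \<in> Reg r S \<Gamma> \<and> snd (P J) \<in> Reg r S \<Gamma> \<and>
        (\<forall>j\<in>{2..J-1}. snd (P j) \<in> Sing r S \<Gamma>) \<longrightarrow>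
        [open_angle d J P = turning_angle (outer_tangent r \<Gamma>) (P 1) (P J)] (rmod (2 * pi)))"

definition P_stratified_straight ::
  "nat \<Rightarrow> (real \<times> nat) rel \<Rightarrow> (nat \<Rightarrow> nat \<Rightarrow> real^2) \<Rightarrow> nat set \<Rightarrow> bool" where
  "P_stratified_straight N r d S \<longleftrightarrow> S \<subseteq> {1..N} \<and>
     (\<exists>(q :: nat) (H :: nat \<Rightarrow> nat set) (\<Sigma> :: nat \<Rightarrow> graph_map).
        H 0 = S \<and> H q = {} \<and> (\<forall>j<q. H (Suc j) \<subset> H j) \<and>
        (\<forall>j<q. network N r (H j) (\<Sigma> j) \<and>
           path_angle_condition r d (H j) (\<Sigma> j) \<and>
           (\<forall>i\<in>H j. straight_segment (curve r (\<Sigma> j) i)) \<and>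
           H (Suc j) = Sing r (H j) (\<Sigma> j)))"

definition P_degenerate ::
  "nat \<Rightarrow> (real \<times> nat) rel \<Rightarrow> (nat \<Rightarrow> nat \<Rightarrow> real^2) \<Rightarrow> graph_map \<Rightarrow> bool" where
  "P_degenerate N r d \<Gamma> \<longleftrightarrow>
     path_angle_condition r d {1..N} \<Gamma> \<and> P_stratified_straight N r d (Sing r {1..N} \<Gamma>)"

end

theory Submission
  imports Defs
begin

text \<open>
  Planar vectors are read as complex numbers. A rotation is then multiplication by a unit complex number, and
  the exponential of an angle between unit vectors is their quotient, so that the angle of a path
  becomes a product of quotients of the vectors \<open>d\<close>.
  
  Suppose that tangents \<open>\<tau>\<close> satisfy the angle condition. The rotations at the vertices cancel in the quotients,
  so the vectors \<open>d\<close> may be replaced by the tangents \<open>\<tau>\<close>. Virtual tangents at the two ends of an edge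
  are opposite, hence along singular edges the product telescopes. What is left is 1 for a cycle of
  singular edges, and the turning angle between the two real tangents for an open path that joins
  regular edges. This is the angle condition in terms of paths (\<open>virtual_imp_path_angle_condition\<close>),
  and it yields one implication stratum by stratum.
  
  For the converse, tangents common to all strata have to be found. They are constructed from the last stratum
  upwards (\<open>P_stratified_imp_V_stratified\<close>); the last stratum has regular curves only and so provides real
  tangents. Suppose that tangents \<open>\<tau>\<close> are known on the singular part of a stratum. Where a regular edge
  meets a singular one, there is exactly one rotation that makes \<open>\<tau>\<close> fit the real tangent. The
  condition on open paths, again by telescoping, says that all contacts with the same connected
  component of the singular part require the same rotation (\<open>fit_factor_unique\<close>). Rotating \<open>\<tau>\<close> on each
  component accordingly gives tangents on the whole stratum (\<open>extend_tangents\<close>).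
  
  The maps of the deeper strata have to follow, since their real tangents are part of \<open>\<tau>\<close>. Rotating a
  map separately on each component preserves continuity, regularity, straightness and the
  angle condition (\<open>stratified_rotated\<close>). Finally, the tangents obtained may serve as virtual tangents
  for the stratum above because a straight immersed segment has opposite outer tangents at its ends
  (\<open>straight_segment_outer_tangents\<close>).
\<close>


section \<open>Rotations and angles in terms of complex numbers\<close>

definition rotation_of :: "complex \<Rightarrow> real^2^2" where
  "rotation_of \<rho> = vector [vector [Re \<rho>, - Im \<rho>], vector [Im \<rho>, Re \<rho>]]"

lemma to_complex_rotation_of: "to_complex (rotation_of \<rho> *v v) = \<rho> * to_complex v"
  by (simp add: to_complex_def rotation_of_def matrix_vector_mult_def sum_2 complex_eq_iff)

lemma rotation_matrix_rotation_of:
  assumes "norm \<rho> = 1"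
  shows "rotation_matrix (rotation_of \<rho>)"
proof -
  have "(Re \<rho>)\<^sup>2 + (Im \<rho>)\<^sup>2 = 1"
    using assms by (simp add: cmod_def)
  then show ?thesis
    by (simp add: rotation_matrix_def orthogonal_matrix_def det_2 rotation_of_def vec_eq_iff
        forall_2 matrix_matrix_mult_def sum_2 transpose_def mat_def power2_eq_square)
qed

lemma rotation_matrix_obtain_complex:
  assumes "rotation_matrix R"
  obtains \<rho> where "norm \<rho> = 1" "\<And>v. to_complex (R *v v) = \<rho> * to_complex v"
proof -
  \<comment> \<open>Orthonormal columns and determinant 1 force the second column to be the first one turned by a
    right angle.\<close>
  have cols: "(R$1$1)\<^sup>2 + (R$2$1)\<^sup>2 = 1" "(R$1$2)\<^sup>2 + (R$2$2)\<^sup>2 = 1"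
    and det: "R$1$1 * R$2$2 - R$1$2 * R$2$1 = 1"
    using assms
    by (auto simp: rotation_matrix_def orthogonal_matrix_def det_2 vec_eq_iff
        forall_2 matrix_matrix_mult_def sum_2 transpose_def mat_def power2_eq_square)
  have "(R$1$1 - R$2$2)\<^sup>2 + (R$1$2 + R$2$1)\<^sup>2 = 0"
    using cols det by (simp add: power2_eq_square algebra_simps)
  then have eqs: "R$2$2 = R$1$1" "R$1$2 = - R$2$1"
    by (auto simp: sum_power2_eq_zero_iff)
  show ?thesis
  proof
    show "norm (Complex (R$1$1) (R$2$1)) = 1"
      using cols by (simp add: cmod_def)
    show "to_complex (R *v v) = Complex (R$1$1) (R$2$1) * to_complex v" for v
      by (simp add: to_complex_def matrix_vector_mult_def sum_2 complex_eq_iff eqs)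
  qed
qed

lemma to_complex_minus: "to_complex (- v) = - to_complex v"
  by (simp add: to_complex_def complex_eq_iff)

lemma to_complex_inject: "to_complex v = to_complex w \<longleftrightarrow> v = w"
  by (simp add: to_complex_def vec_eq_iff forall_2)

lemma norm_to_complex: "norm (to_complex v) = norm v"
  by (simp add: to_complex_def norm_vec_def L2_set_def sum_2 cmod_def)

lemma to_complex_nonzero: "norm v = 1 \<Longrightarrow> to_complex v \<noteq> 0"
  by (metis norm_to_complex norm_zero zero_neq_one)

lemma norm_rotation:
  fixes R :: "real^2^2"
  assumes "rotation_matrix R"
  shows "norm (R *v v) = norm v"
  using assms by (metis mult_1 norm_mult norm_to_complex rotation_matrix_obtain_complex)

lemma matrix_vector_mult_uminus:
  fixes A :: "real^'n^'m"
  shows "A *v (- v) = - (A *v v)"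
  using matrix_vector_mult_scaleR[of A "-1" v] by simp

text \<open>
  Exponentiating makes congruences modulo \<open>2 * pi\<close> into equations between unit complex numbers, and sums of
  angles into products of quotients. All angle computations below are carried out in this form.
\<close>

lemma cis_ccw_angle:
  assumes "norm a = 1" "norm b = 1"
  shows "cis (ccw_angle a b) = to_complex b / to_complex a"
proof -
  have "to_complex b / to_complex a \<noteq> 0" "norm (to_complex b / to_complex a) = 1"
    using assms by (auto simp: to_complex_nonzero norm_divide norm_to_complex)
  then show ?thesis
    by (simp add: ccw_angle_def cis_Arg sgn_div_norm)
qed

lemma cis_turning_angle:
  assumes "norm (\<tau> (1 - z) i) = 1" "norm (\<tau> w k) = 1"
  shows "cis (turning_angle \<tau> (z, i) (w, k)) = - to_complex (\<tau> w k) / to_complex (\<tau> (1 - z) i)"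
  using cis_ccw_angle[of "- \<tau> (1 - z) i" "\<tau> w k"] assms
  by (simp add: turning_angle_def to_complex_minus)


section \<open>Tangents at the endpoints of the edges\<close>

text \<open>
  The vertex part of the angle condition, for an arbitrary family of tangents. Separating it from
  \<open>virtual_angle_condition\<close> allows it to be used for tangents that are given on the singular edges
  without reference to a map.
\<close>

definition matches_angles ::
  "(real \<times> nat) rel \<Rightarrow> (nat \<Rightarrow> nat \<Rightarrow> real^2) \<Rightarrow> nat set \<Rightarrow> (nat \<Rightarrow> nat \<Rightarrow> real^2) \<Rightarrow> bool" where
  "matches_angles r d S \<tau> \<longleftrightarrow>
     (\<forall>p\<in>vertices r S. \<exists>R :: real^2^2. rotation_matrix R \<and>
        (\<forall>z\<in>{0, 1}. \<forall>i\<in>S. vertex r z i = p \<longrightarrow> \<tau> z i = R *v d z i))"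

text \<open>
  Opposite unit tangents at the two ends of every edge: virtual tangents have this property by
  definition, the real tangents of straight segments by \<open>straight_segment_outer_tangents\<close> below.
\<close>

definition straight_tangents :: "nat set \<Rightarrow> (nat \<Rightarrow> nat \<Rightarrow> real^2) \<Rightarrow> bool" where
  "straight_tangents S \<tau> \<longleftrightarrow>
     (\<forall>i\<in>S. norm (\<tau> 0 i) = 1 \<and> norm (\<tau> 1 i) = 1 \<and> \<tau> 0 i = - \<tau> 1 i)"

lemma straight_tangentsD:
  assumes "straight_tangents S \<tau>" "i \<in> S" "z \<in> {0, 1}"
  shows "norm (\<tau> z i) = 1" "\<tau> (1 - z) i = - \<tau> z i"
  using assms by (auto simp: straight_tangents_def)

lemma virtual_angle_condition_iff:
  "virtual_angle_condition r d S \<Gamma> \<tau> \<longleftrightarrow>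
     (\<forall>i\<in>Reg r S \<Gamma>. \<forall>z\<in>{0, 1}. \<tau> z i = outer_tangent r \<Gamma> z i) \<and>
     straight_tangents (Sing r S \<Gamma>) \<tau> \<and> matches_angles r d S \<tau>"
  by (simp add: virtual_angle_condition_def straight_tangents_def matches_angles_def)

lemma matches_anglesD:
  assumes "matches_angles r d S \<tau>" "p \<in> vertices r S"
  shows "\<exists>R :: real^2^2. rotation_matrix R \<and>
    (\<forall>z\<in>{0, 1}. \<forall>i\<in>S. vertex r z i = p \<longrightarrow> \<tau> z i = R *v d z i)"
  using assms(2) by (rule bspec[OF assms(1)[unfolded matches_angles_def]])

text \<open>
  The common rotation at a vertex is multiplication of all tangents by the same unit complex number,
  so it cancels in quotients: assigned and actual angles between two edges are equal.
\<close>

lemma matches_angles_turn: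
  assumes "matches_angles r d S \<tau>" "i \<in> S" "k \<in> S" "z \<in> {0, 1}" "w \<in> {0, 1}"
    and "vertex r z i = vertex r w k"
  shows "to_complex (d w k) * to_complex (\<tau> z i) = to_complex (d z i) * to_complex (\<tau> w k)"
proof -
  have "vertex r z i \<in> vertices r S"
    using assms by (auto simp: vertices_def)
  then obtain R :: "real^2^2" where R: "rotation_matrix R" "\<tau> z i = R *v d z i" "\<tau> w k = R *v d w k"
    using assms unfolding matches_angles_def by metis
  then show ?thesis
    by (metis mult.commute mult.left_commute rotation_matrix_obtain_complex)
qed

lemma matches_angles_norm:
  assumes "matches_angles r d S \<tau>" "i \<in> S" "z \<in> {0, 1}"
  shows "norm (\<tau> z i) = norm (d z i)"
proof -
  have "vertex r z i \<in> vertices r S"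
    using assms by (auto simp: vertices_def)
  then obtain R :: "real^2^2" where R: "rotation_matrix R" "\<tau> z i = R *v d z i"
    using assms unfolding matches_angles_def by metis
  then show ?thesis
    by (metis mult_1 norm_mult norm_to_complex rotation_matrix_obtain_complex)
qed

lemma velocity_eqI:
  assumes "(\<gamma> has_vector_derivative v) (at t within {0..1})" "t \<in> {0..1}"
  shows "velocity \<gamma> t = v"
  using assms vector_derivative_within_cbox[of 0 1 t \<gamma> v] by simp

lemma regular_not_singular:
  assumes "regular_curve \<gamma>"
  shows "\<not> singular_curve \<gamma>"
proof
  assume "singular_curve \<gamma>"
  then obtain c where "\<And>t. t \<in> {0..1} \<Longrightarrow> \<gamma> t = c"
    by (auto simp: singular_curve_def constant_on_def)
  then have "(\<gamma> has_vector_derivative 0) (at 0 within {0..1})"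
    using has_vector_derivative_transform[of 0 "{0..1}" \<gamma> "\<lambda>_. c" 0] by simp
  then have "velocity \<gamma> 0 = 0"
    by (rule velocity_eqI) simp
  then show False
    using assms by (auto simp: regular_curve_def immersion_def)
qed
text \<open>
  Write the curve as \<open>a + s t *\<^sub>R b\<close> with \<open>s\<close> a function into \<open>[0,1]\<close> that is 0 at 0 and 1 at 1. Since \<open>s\<close> has
  its minimum at 0 and its maximum at 1, its derivatives there are nonnegative, and they do not vanish
  because the curve is an immersion. Hence both end velocities are positive multiples of \<open>b\<close>.
\<close>

lemma straight_segment_outer_tangents:
  assumes "regular_curve (curve r \<Gamma> i)" "straight_segment (curve r \<Gamma> i)"
  shows "outer_tangent r \<Gamma> 0 i = - outer_tangent r \<Gamma> 1 i"
proof -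
  define \<gamma> where "\<gamma> = curve r \<Gamma> i"
  define a b where "a = \<gamma> 0" and "b = \<gamma> 1 - \<gamma> 0"
  define s where "s t = ((\<gamma> t - a) \<bullet> b) / (b \<bullet> b)" for t
  have imm: "\<gamma> differentiable (at t within {0..1})" "velocity \<gamma> t \<noteq> 0" if "t \<in> {0..1}" for t
    using assms(1) that by (auto simp: regular_curve_def immersion_def \<gamma>_def)
  have vel: "(\<gamma> has_vector_derivative velocity \<gamma> t) (at t within {0..1})" if "t \<in> {0..1}" for t
    using imm(1)[OF that] by (simp add: vector_derivative_works)
  have seg: "\<exists>u. 0 \<le> u \<and> u \<le> 1 \<and> \<gamma> t = a + u *\<^sub>R b" if "t \<in> {0..1}" for t
  proof -
    have "\<gamma> t \<in> closed_segment (\<gamma> 0) (\<gamma> 1)"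
      using assms(2) that unfolding straight_segment_def \<gamma>_def[symmetric] by blast
    then show ?thesis
      by (auto simp: closed_segment_def a_def b_def algebra_simps)
  qed
  have "b \<noteq> 0"
  proof
    assume "b = 0"
    then have "\<gamma> t = a" if "t \<in> {0..1}" for t
      using seg[OF that] by auto
    then have "singular_curve \<gamma>"
      unfolding singular_curve_def constant_on_def by blast
    then show False
      using regular_not_singular assms(1) by (simp add: \<gamma>_def)
  qed
  have s: "0 \<le> s t \<and> s t \<le> 1 \<and> \<gamma> t = a + s t *\<^sub>R b" if "t \<in> {0..1}" for t
  proof -
    obtain u where u: "0 \<le> u" "u \<le> 1" "\<gamma> t = a + u *\<^sub>R b" using seg[OF \<open>t \<in> {0..1}\<close>] by blast
    then have "s t = u" using \<open>b \<noteq> 0\<close> by (simp add: s_def)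
    with u show ?thesis by simp
  qed
  have s_ends: "s 0 = 0" "s 1 = 1"
    using \<open>b \<noteq> 0\<close> by (simp_all add: s_def a_def b_def)
  have "\<exists>c>0. velocity \<gamma> t = c *\<^sub>R b" if "t \<in> {0, 1}" for t
  proof -
    have t: "t \<in> {0..1}" using that by auto
    define c where "c = (velocity \<gamma> t \<bullet> b) / (b \<bullet> b)"
    have "((\<lambda>t. \<gamma> t - a) has_vector_derivative velocity \<gamma> t) (at t within {0..1})"
      using has_vector_derivative_diff[OF vel[OF t] has_vector_derivative_const] by simp
    moreover have "bounded_linear (\<lambda>x. (x \<bullet> b) / (b \<bullet> b))"
      by (intro bounded_linear_compose[OF bounded_linear_divide bounded_linear_inner_left])
    ultimately have sd: "(s has_vector_derivative c) (at t within {0..1})"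
      unfolding s_def c_def by (rule bounded_linear.has_vector_derivative[rotated])
    then have "((\<lambda>t. a + s t *\<^sub>R b) has_vector_derivative c *\<^sub>R b) (at t within {0..1})"
      by (auto intro!: derivative_eq_intros simp: has_real_derivative_iff_has_vector_derivative)
    then have "(\<gamma> has_vector_derivative c *\<^sub>R b) (at t within {0..1})"
      by (rule has_vector_derivative_transform[rotated 2]) (use s t in auto)
    then have v: "velocity \<gamma> t = c *\<^sub>R b"
      using t by (rule velocity_eqI)
    have "((\<lambda>y. (s y - s t) / (y - t)) \<longlongrightarrow> c) (at t within {0..1})"
      using sd by (simp add: has_real_derivative_iff_has_vector_derivative[symmetric] has_field_derivative_iff)
    moreover have "\<forall>\<^sub>F y in at t within {0..1}. 0 \<le> (s y - s t) / (y - t)"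
    proof -
      have "0 \<le> (s y - s t) / (y - t)" if "y \<in> {0..1}" for y
        using \<open>t \<in> {0, 1}\<close> s[OF that] that s_ends
        by (auto intro: divide_nonneg_nonneg divide_nonpos_nonpos)
      then show ?thesis by (auto simp: eventually_at_filter)
    qed
    moreover have "at t within {0..1} \<noteq> bot"
      using t by (simp add: trivial_limit_within islimpt_Icc)
    ultimately have "0 \<le> c" by (rule tendsto_lowerbound)
    moreover have "c \<noteq> 0" using v imm(2)[OF t] by auto
    ultimately show ?thesis using v by (intro exI[of _ c]) auto
  qed
  then obtain c0 c1 where "c0 > 0" "velocity \<gamma> 0 = c0 *\<^sub>R b" "c1 > 0" "velocity \<gamma> 1 = c1 *\<^sub>R b"
    by (metis insertI1 insert_iff)
  then show ?thesis
    by (simp add: outer_tangent_def \<gamma>_def[symmetric])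
qed

lemma network_Reg_Sing:
  assumes "network N r S \<Phi>"
  shows "S = Reg r S \<Phi> \<union> Sing r S \<Phi>"
  using assms by (auto simp: network_def Reg_def Sing_def)

lemma norm_outer_tangent:
  assumes "regular_curve (curve r \<Gamma> i)" "z \<in> {0, 1}"
  shows "norm (outer_tangent r \<Gamma> z i) = 1"
proof -
  have "velocity (curve r \<Gamma> i) (real z) \<noteq> 0"
    using assms by (auto simp: regular_curve_def immersion_def)
  then show ?thesis using assms(2) by (auto simp: outer_tangent_def)
qed


section \<open>From virtual tangents to paths\<close>

lemma is_path_snoc:
  assumes "is_path r S J P" "b \<in> {0, 1} \<times> S" "end_vertex r (P J) = start_vertex r b"
  shows "is_path r S (Suc J) (P(Suc J := b))"
  using assms by (auto simp: is_path_def le_Suc_eq less_Suc_eq)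

lemma open_angle_Suc:
  assumes "1 \<le> J"
  shows "open_angle d (Suc J) P = open_angle d J P + turning_angle d (P J) (P (Suc J))"
  using assms by (simp add: open_angle_def atLeastLessThanSuc)

lemma open_angle_cong:
  assumes "\<And>j. j \<in> {1..J} \<Longrightarrow> P j = P' j"
  shows "open_angle d J P = open_angle d J P'"
  unfolding open_angle_def using assms by (intro sum.cong) auto

lemma cis_turning_angle_matches:
  assumes "matches_angles r d S \<tau>" "\<And>z i. z \<in> {0, 1} \<Longrightarrow> i \<in> S \<Longrightarrow> norm (d z i) = 1"
    and "a \<in> {0, 1} \<times> S" "b \<in> {0, 1} \<times> S" "end_vertex r a = start_vertex r b"
  shows "cis (turning_angle d a b) = cis (turning_angle \<tau> a b)"
proof -
  obtain z i w k where ab: "a = (z, i)" "b = (w, k)" by fastforce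
  have mem: "1 - z \<in> {0, 1}" "w \<in> {0, 1}" "i \<in> S" "k \<in> S"
    using assms(3,4) by (auto simp: ab)
  have v: "vertex r (1 - z) i = vertex r w k"
    using assms(5) by (simp add: ab start_vertex_def end_vertex_def)
  have d: "norm (d (1 - z) i) = 1" "norm (d w k) = 1"
    using assms(2) mem by blast+
  then have t: "norm (\<tau> (1 - z) i) = 1" "norm (\<tau> w k) = 1"
    using matches_angles_norm[OF assms(1)] mem by simp_all
  have "to_complex (d w k) * to_complex (\<tau> (1 - z) i) = to_complex (d (1 - z) i) * to_complex (\<tau> w k)"
    using matches_angles_turn[OF assms(1) mem(3,4,1,2) v] .
  then show ?thesis
    using d t by (simp add: ab cis_turning_angle to_complex_nonzero field_simps)
qed

text \<open>
  After replacing \<open>d\<close> by \<open>\<tau>\<close>, the angle of the path is a product of quotients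
  \<open>- \<tau>\<^sub>j\<^sub>+\<^sub>1 / \<tau>\<^sub>j'\<close>, where \<open>\<tau>\<^sub>j'\<close> is the tangent at the end of the \<open>j\<close>-th edge and \<open>\<tau>\<^sub>j\<^sub>+\<^sub>1\<close> the one at the
  start of the next. On the intermediate edges the tangents at start and end are opposite, so that
  everything cancels except the tangents at the end of the first edge and at the start of the last.
\<close>

lemma cis_open_angle_telescopes:
  assumes "matches_angles r d S \<tau>" "\<And>z i. z \<in> {0, 1} \<Longrightarrow> i \<in> S \<Longrightarrow> norm (d z i) = 1"
    and "straight_tangents T \<tau>"
    and "2 \<le> J" "is_path r S J P" "\<forall>j\<in>{2..J-1}. snd (P j) \<in> T"
  shows "cis (open_angle d J P) = cis (turning_angle \<tau> (P 1) (P J))"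
  using assms(4-6)
proof (induction J rule: nat_induct_at_least)
  case base
  have "cis (turning_angle d (P 1) (P 2)) = cis (turning_angle \<tau> (P 1) (P 2))"
    using base(1) by (intro cis_turning_angle_matches[OF assms(1,2)]) (auto simp: is_path_def numeral_2_eq_2)
  moreover have "{1..<2::nat} = {1}" by auto
  ultimately show ?case by (simp add: open_angle_def numeral_2_eq_2)
next
  case (Suc J)
  obtain z i w k u l where P: "P 1 = (z, i)" "P J = (w, k)" "P (Suc J) = (u, l)"
    by (meson surj_pair)
  have mem: "P 1 \<in> {0, 1} \<times> S" "P J \<in> {0, 1} \<times> S" "P (Suc J) \<in> {0, 1} \<times> S"
    using Suc.prems(1) Suc.hyps unfolding is_path_def by auto
  have "cis (turning_angle d (P J) (P (Suc J))) = cis (turning_angle \<tau> (P J) (P (Suc J)))"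
    using Suc.prems(1) Suc.hyps mem
    by (intro cis_turning_angle_matches[OF assms(1,2)]) (auto simp: is_path_def)
  moreover have "cis (open_angle d J P) = cis (turning_angle \<tau> (P 1) (P J))"
    using Suc.prems Suc.hyps by (intro Suc.IH) (auto simp: is_path_def)
  moreover have "norm (\<tau> (1 - z) i) = 1" "norm (\<tau> w k) = 1" "norm (\<tau> (1 - w) k) = 1" "norm (\<tau> u l) = 1"
    using matches_angles_norm[OF assms(1)] assms(2) mem unfolding P by (auto simp: P)
  moreover have "to_complex (\<tau> (1 - w) k) = - to_complex (\<tau> w k)"
    using straight_tangentsD(2)[OF assms(3), of k w] mem(2) Suc.prems(2) Suc.hyps P(2)
    by (force simp: to_complex_minus)
  ultimately show ?case
    using Suc.hyps
    by (simp add: open_angle_Suc cis_mult[symmetric] P P(1)[unfolded One_nat_def] cis_turning_angle to_complex_nonzero)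
qed

lemma virtual_imp_path_angle_condition:
  assumes "\<And>z i. z \<in> {0, 1} \<Longrightarrow> i \<in> S \<Longrightarrow> norm (d z i) = 1"
    and "virtual_angle_condition r d S \<Gamma> \<tau>"
  shows "path_angle_condition r d S \<Gamma>"
  unfolding path_angle_condition_def
proof (intro conjI allI impI)
  have reg: "\<And>i z. i \<in> Reg r S \<Gamma> \<Longrightarrow> z \<in> {0, 1} \<Longrightarrow> \<tau> z i = outer_tangent r \<Gamma> z i"
    and str: "straight_tangents (Sing r S \<Gamma>) \<tau>" and mat: "matches_angles r d S \<tau>"
    using assms(2) by (auto simp: virtual_angle_condition_iff)
  note telescope = cis_open_angle_telescopes[OF mat assms(1) str]
  show "\<forall>p\<in>vertices r S. \<exists>R :: real^2^2. rotation_matrix R \<and> (\<forall>z\<in>{0, 1}. \<forall>i\<in>Reg r S \<Gamma>.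
      vertex r z i = p \<longrightarrow> outer_tangent r \<Gamma> z i = R *v d z i)"
  proof
    fix p assume "p \<in> vertices r S"
    from matches_anglesD[OF mat this] obtain R :: "real^2^2" where "rotation_matrix R"
        "\<forall>z\<in>{0, 1}. \<forall>i\<in>S. vertex r z i = p \<longrightarrow> \<tau> z i = R *v d z i"
      by (elim exE conjE)
    moreover have "Reg r S \<Gamma> \<subseteq> S" by (auto simp: Reg_def)
    ultimately show "\<exists>R :: real^2^2. rotation_matrix R \<and> (\<forall>z\<in>{0, 1}. \<forall>i\<in>Reg r S \<Gamma>.
      vertex r z i = p \<longrightarrow> outer_tangent r \<Gamma> z i = R *v d z i)"
      by (intro exI[of _ R]) (metis reg subsetD)
  qed
  fix J and P :: "nat \<Rightarrow> nat \<times> nat"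
  {
    assume cyc: "is_cycle r S J P \<and> (\<forall>j\<in>{1..J}. snd (P j) \<in> Sing r S \<Gamma>)"
    \<comment> \<open>A cycle is read as an open path that returns to its first edge: all of its intermediate
      edges are then singular, and the turning angle that closes the cycle is part of the sum.\<close>
    define P' where "P' = P(Suc J := P 1)"
    have J: "1 \<le> J" using cyc by (auto simp: is_cycle_def is_path_def)
    obtain z i where zi: "P 1 = (z, i)" by fastforce
    have "P 1 \<in> {0, 1} \<times> S" "snd (P 1) \<in> Sing r S \<Gamma>"
      using cyc J by (simp_all add: is_cycle_def is_path_def)
    then have z: "z \<in> {0, 1}" "i \<in> Sing r S \<Gamma>"
      by (simp_all only: zi mem_Times_iff fst_conv snd_conv)
    have "open_angle d J P' = open_angle d J P"
      by (rule open_angle_cong) (auto simp: P'_def)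
    then have "cycle_angle d J P = open_angle d (Suc J) P'"
      using J by (simp add: open_angle_Suc cycle_angle_def P'_def)
    also have "cis \<dots> = cis (turning_angle \<tau> (P' 1) (P' (Suc J)))"
    proof (rule telescope)
      show "is_path r S (Suc J) P'"
        using cyc J by (auto simp: is_cycle_def is_path_def P'_def le_Suc_eq less_Suc_eq)
      show "\<forall>j\<in>{2..Suc J - 1}. snd (P' j) \<in> Sing r S \<Gamma>"
        using cyc by (auto simp: P'_def)
    qed (use J in auto)
    also have "\<dots> = cis (turning_angle \<tau> (z, i) (z, i))"
      using J zi by (simp add: P'_def)
    also have "\<dots> = 1"
      using straight_tangentsD[OF str z(2,1)]
      by (simp add: cis_turning_angle to_complex_minus to_complex_nonzero)
    finally show "[cycle_angle d J P = 0] (rmod (2 * pi))"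
      by (simp add: cis_eq_iff[symmetric])
  }
  {
    assume P: "is_path r S J P \<and> 2 \<le> J \<and> snd (P 1) \<in> Reg r S \<Gamma> \<and> snd (P J) \<in> Reg r S \<Gamma> \<and>
      (\<forall>j\<in>{2..J-1}. snd (P j) \<in> Sing r S \<Gamma>)"
    obtain z i w k where zi: "P 1 = (z, i)" "P J = (w, k)" by (meson surj_pair)
    have "P 1 \<in> {0, 1} \<times> S" "P J \<in> {0, 1} \<times> S"
      using P by (auto simp: is_path_def)
    moreover have "i \<in> Reg r S \<Gamma>" "k \<in> Reg r S \<Gamma>"
      using P unfolding zi by simp_all
    ultimately have "\<tau> (1 - z) i = outer_tangent r \<Gamma> (1 - z) i" "\<tau> w k = outer_tangent r \<Gamma> w k"
      unfolding zi by (auto intro!: reg)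
    then have "turning_angle \<tau> (P 1) (P J) = turning_angle (outer_tangent r \<Gamma>) (P 1) (P J)"
      unfolding zi by (simp add: turning_angle_def)
    then show "[open_angle d J P = turning_angle (outer_tangent r \<Gamma>) (P 1) (P J)] (rmod (2 * pi))"
      using telescope[of J P] P by (simp add: cis_eq_iff[symmetric])
  }
qed


section \<open>Components of the singular subgraph\<close>

text \<open>
  The relation is between directed edges rather than edges, so that its chains are paths in the sense
  of \<open>is_path\<close>. Since an edge may be traversed back immediately, its reflexive transitive closure
  still is the equivalence relation that describes the connected components.
\<close>

definition follows :: "(real \<times> nat) rel \<Rightarrow> nat set \<Rightarrow> nat \<times> nat \<Rightarrow> nat \<times> nat \<Rightarrow> bool" where
  "follows r T a b \<longleftrightarrow> a \<in> {0, 1} \<times> T \<and> b \<in> {0, 1} \<times> T \<and> end_vertex r a = start_vertex r b"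

lemma follows_backtrack:
  assumes "z \<in> {0, 1}" "i \<in> T"
  shows "follows r T (z, i) (1 - z, i)"
  using assms by (auto simp: follows_def start_vertex_def end_vertex_def)

lemma follows_at_vertex:
  assumes "z \<in> {0, 1}" "w \<in> {0, 1}" "i \<in> T" "k \<in> T" "vertex r z i = vertex r w k"
  shows "follows r T (1 - z, i) (w, k)"
proof -
  have "1 - z \<in> {0, 1}" "1 - (1 - z) = z"
    using assms(1) by auto
  then show ?thesis
    using assms(2-) by (simp only: follows_def start_vertex_def end_vertex_def) simp
qed

lemma follows_reverse:
  assumes "follows r T (z, i) (w, k)"
  shows "follows r T (1 - w, k) (1 - z, i)"
proof (rule follows_at_vertex)
  show "vertex r w k = vertex r (1 - z) i"
    using assms by (simp add: follows_def start_vertex_def end_vertex_def)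
qed (use assms in \<open>auto simp: follows_def\<close>)

lemma reachable_sym:
  assumes "(follows r T)\<^sup>*\<^sup>* a b"
  shows "(follows r T)\<^sup>*\<^sup>* b a"
  using assms
proof induction
  case (step b c)
  obtain z i w k where bc: "b = (z, i)" "c = (w, k)" by fastforce
  then have m: "z \<in> {0, 1}" "i \<in> T" "w \<in> {0, 1}" "k \<in> T"
    using step(2) by (auto simp: follows_def)
  then have "1 - (1 - z) = z" by auto
  then have "follows r T c (1 - w, k)" "follows r T (1 - w, k) (1 - z, i)" "follows r T (1 - z, i) b"
    using follows_backtrack[OF m(3,4)] follows_reverse step(2) follows_backtrack[of "1 - z" i T r] m
    by (auto simp: bc)
  with step.IH show ?case
    by (meson converse_rtranclp_into_rtranclp)
qed simp

text \<open>
  The angle of a path that enters a component at the edge \<open>a\<close> and walks in it up to the edge \<open>c\<close>.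
  The tangents \<open>\<tau>\<close> need not match the angle at which the first edge \<open>b\<close> meets \<open>a\<close>: that turning
  angle is kept in terms of \<open>d\<close>, and the telescoping concerns the rest of the path only.
\<close>

lemma walk_through_component:
  assumes mat: "matches_angles r d T \<tau>" and unit: "\<And>z i. z \<in> {0, 1} \<Longrightarrow> i \<in> S \<Longrightarrow> norm (d z i) = 1"
    and str: "straight_tangents T \<tau>" and "T \<subseteq> S"
    and ba: "b \<in> {0, 1} \<times> S" "a \<in> {0, 1} \<times> T" "end_vertex r b = start_vertex r a"
    and "(follows r T)\<^sup>*\<^sup>* a c"
  shows "\<exists>J P. 2 \<le> J \<and> is_path r S J P \<and> P 1 = b \<and> P J = c \<and> (\<forall>j\<in>{2..J}. snd (P j) \<in> T) \<and>
     cis (open_angle d J P) =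
       cis (turning_angle d b a) * to_complex (case_prod \<tau> c) / to_complex (case_prod \<tau> a)"
  using assms(8)
proof (induction rule: rtranclp_induct)
  case base
  define P where "P j = (if j = 1 then b else a)" for j :: nat
  \<comment> \<open>The path of the two edges \<open>b\<close> and \<open>a\<close>.\<close>
  have sets: "{1..<2::nat} = {1}" "{1..2::nat} = {1, 2}" "{2..2::nat} = {2}" by auto
  have P: "P 1 = b" "P 2 = a" by (simp_all add: P_def)
  have "norm (case_prod \<tau> a) = 1"
    using straight_tangentsD(1)[OF str] ba(2) by (cases a) auto
  then have "cis (open_angle d 2 P) =
       cis (turning_angle d b a) * to_complex (case_prod \<tau> a) / to_complex (case_prod \<tau> a)"
    unfolding open_angle_def sets by (simp add: P_def to_complex_nonzero)
  moreover have "is_path r S 2 P"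
    unfolding is_path_def sets using ba \<open>T \<subseteq> S\<close> by (auto simp: P P_def)
  moreover have "\<forall>j\<in>{2..2}. snd (P j) \<in> T"
    using ba(2) by (auto simp: sets P)
  ultimately show ?case
    using P by blast
next
  case (step c e)
  then obtain J P where P: "2 \<le> J" "is_path r S J P" "P 1 = b" "P J = c"
      "\<forall>j\<in>{2..J}. snd (P j) \<in> T"
    and ang: "cis (open_angle d J P) =
       cis (turning_angle d b a) * to_complex (case_prod \<tau> c) / to_complex (case_prod \<tau> a)"
    by blast
  define P' where "P' = P(Suc J := e)"
  have ce: "c \<in> {0, 1} \<times> T" "e \<in> {0, 1} \<times> T" "end_vertex r c = start_vertex r e"
    using step(2) by (auto simp: follows_def)
  have path: "is_path r S (Suc J) P'"
    unfolding P'_def using P(2,4) ce \<open>T \<subseteq> S\<close> by (intro is_path_snoc) auto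
  have "open_angle d J P' = open_angle d J P"
    by (rule open_angle_cong) (auto simp: P'_def)
  then have oa: "open_angle d (Suc J) P' = open_angle d J P + turning_angle d c e"
    using P by (simp add: open_angle_Suc P'_def)
  obtain z i w k where zw: "c = (z, i)" "e = (w, k)" by fastforce
  then have zi: "z \<in> {0, 1}" "i \<in> T" "w \<in> {0, 1}" "k \<in> T" "1 - z \<in> {0, 1}" using ce by auto
  have "cis (turning_angle d c e) = cis (turning_angle \<tau> c e)"
    using ce unit \<open>T \<subseteq> S\<close> by (intro cis_turning_angle_matches[OF mat]) auto
  \<comment> \<open>The tangent at the end of the edge \<open>i\<close> is minus the one at its start.\<close>
  also have "\<dots> = to_complex (\<tau> w k) / to_complex (\<tau> z i)"
    using straight_tangentsD[OF str] zi
    by (auto simp: zw cis_turning_angle to_complex_minus)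
  finally have "cis (open_angle d (Suc J) P') =
       cis (turning_angle d b a) * to_complex (case_prod \<tau> e) / to_complex (case_prod \<tau> a)"
    using straight_tangentsD(1)[OF str zi(2,1)]
    by (simp add: oa cis_mult[symmetric] ang zw to_complex_nonzero)
  moreover have "P' 1 = b" "P' (Suc J) = e" "2 \<le> Suc J" "\<forall>j\<in>{2..Suc J}. snd (P' j) \<in> T"
    using P ce(2) by (auto simp: P'_def le_Suc_eq)
  ultimately show ?case
    using path by blast
qed


section \<open>Extending tangents from the singular to the regular edges\<close>

text \<open>
  Where the end \<open>(z, i)\<close> of a regular edge meets the end \<open>(w, k)\<close> of a singular one, this is the
  rotation that has to be applied to the tangent \<open>\<tau> w k\<close> in order that it forms the assigned angle with
  the real tangent of the regular edge.
\<close>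

definition fit_factor ::
  "(real \<times> nat) rel \<Rightarrow> (nat \<Rightarrow> nat \<Rightarrow> real^2) \<Rightarrow> graph_map \<Rightarrow> (nat \<Rightarrow> nat \<Rightarrow> real^2) \<Rightarrow>
     nat \<times> nat \<Rightarrow> nat \<times> nat \<Rightarrow> complex" where
  "fit_factor r d \<Phi> \<tau> = (\<lambda>(z, i) (w, k).
     to_complex (outer_tangent r \<Phi> z i) / to_complex (d z i) *
     (to_complex (d w k) / to_complex (\<tau> w k)))"

definition contact ::
  "(real \<times> nat) rel \<Rightarrow> nat set \<Rightarrow> graph_map \<Rightarrow> nat \<times> nat \<Rightarrow> nat \<times> nat \<Rightarrow> bool" where
  "contact r S \<Phi> a b \<longleftrightarrow> a \<in> {0, 1} \<times> Reg r S \<Phi> \<and> b \<in> {0, 1} \<times> Sing r S \<Phi> \<and>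
     start_vertex r a = start_vertex r b"

lemma norm_fit_factor:
  assumes "\<And>z i. z \<in> {0, 1} \<Longrightarrow> i \<in> S \<Longrightarrow> norm (d z i) = 1"
    and "straight_tangents (Sing r S \<Phi>) \<tau>" and "contact r S \<Phi> a b"
  shows "norm (fit_factor r d \<Phi> \<tau> a b) = 1"
  using assms straight_tangentsD(1)[OF assms(2)]
  by (auto simp: fit_factor_def contact_def norm_mult norm_divide norm_to_complex
      norm_outer_tangent Reg_def Sing_def)

text \<open>
  The condition on open paths, applied to a path that comes in along the regular edge of the first contact,
  walks through the component, and leaves along the regular edge of the second one.
\<close>

lemma fit_factor_unique:
  assumes unit: "\<And>z i. z \<in> {0, 1} \<Longrightarrow> i \<in> S \<Longrightarrow> norm (d z i) = 1"
    and path: "path_angle_condition r d S \<Phi>"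
    and mat: "matches_angles r d (Sing r S \<Phi>) \<tau>" and str: "straight_tangents (Sing r S \<Phi>) \<tau>"
    and con: "contact r S \<Phi> a b" "contact r S \<Phi> a' b'"
    and reach: "(follows r (Sing r S \<Phi>))\<^sup>*\<^sup>* b b'"
  shows "fit_factor r d \<Phi> \<tau> a b = fit_factor r d \<Phi> \<tau> a' b'"
proof -
  let ?T = "Sing r S \<Phi>"
  obtain z i w k z' i' w' k' where
    ab: "a = (z, i)" "b = (w, k)" "a' = (z', i')" "b' = (w', k')" by (meson surj_pair)
  have TS: "?T \<subseteq> S" "Reg r S \<Phi> \<subseteq> S" by (auto simp: Sing_def Reg_def)
  have mem: "z \<in> {0,1}" "i \<in> Reg r S \<Phi>" "w \<in> {0,1}" "k \<in> ?T"
      "z' \<in> {0,1}" "i' \<in> Reg r S \<Phi>" "w' \<in> {0,1}" "k' \<in> ?T"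
    and v: "vertex r z i = vertex r w k" "vertex r z' i' = vertex r w' k'"
    using con by (auto simp: contact_def ab start_vertex_def)
  have inv: "1 - (1 - z) = z" "1 - (1 - w') = w'" using mem by auto
  \<comment> \<open>The path arrives at \<open>b\<close> along the regular edge of \<open>a\<close> and has to leave the edge of \<open>b'\<close>
    through its endpoint \<open>w'\<close>, hence it traverses that edge towards \<open>w'\<close> at the end.\<close>
  have "(follows r ?T)\<^sup>*\<^sup>* b (1 - w', k')"
    using reach follows_backtrack[OF mem(7,8), of r] by (auto simp: ab intro: rtranclp.rtrancl_into_rtrancl)
  moreover have "(1 - z, i) \<in> {0, 1} \<times> S" "b \<in> {0, 1} \<times> ?T" "end_vertex r (1 - z, i) = start_vertex r b"
    using mem TS v inv by (auto simp: ab end_vertex_def start_vertex_def)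
  ultimately have "\<exists>J P. 2 \<le> J \<and> is_path r S J P \<and> P 1 = (1 - z, i) \<and> P J = (1 - w', k') \<and>
      (\<forall>j\<in>{2..J}. snd (P j) \<in> ?T) \<and>
      cis (open_angle d J P) = cis (turning_angle d (1 - z, i) b) *
       to_complex (case_prod \<tau> (1 - w', k')) / to_complex (case_prod \<tau> b)"
    by (intro walk_through_component[OF mat unit str TS(1)])
  then obtain J P where P: "2 \<le> J" "is_path r S J P" "P 1 = (1 - z, i)" "P J = (1 - w', k')"
      "\<forall>j\<in>{2..J}. snd (P j) \<in> ?T"
    and ang: "cis (open_angle d J P) = cis (turning_angle d (1 - z, i) b) *
       to_complex (\<tau> (1 - w') k') / to_complex (\<tau> w k)"
    unfolding ab(2) case_prod_conv by (elim exE conjE)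
  define P' where "P' = P(Suc J := (z', i'))"
  have "is_path r S (Suc J) P'"
    unfolding P'_def
  proof (rule is_path_snoc[OF P(2)])
    show "(z', i') \<in> {0, 1} \<times> S"
      using mem(5,6) TS by blast
    show "end_vertex r (P J) = start_vertex r (z', i')"
      unfolding P(4) end_vertex_def start_vertex_def case_prod_conv inv v(2) ..
  qed
  moreover have "P' 1 = (1 - z, i)" "P' (Suc J) = (z', i')"
    using P by (auto simp: P'_def)
  moreover have "\<forall>j\<in>{2..Suc J - 1}. snd (P' j) \<in> ?T"
    using P by (auto simp: P'_def)
  ultimately have "[open_angle d (Suc J) P' =
      turning_angle (outer_tangent r \<Phi>) (1 - z, i) (z', i')] (rmod (2 * pi))"
    using path mem P(1) unfolding path_angle_condition_def
    by (metis le_SucI snd_conv)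
  moreover have "open_angle d J P' = open_angle d J P"
    by (rule open_angle_cong) (auto simp: P'_def)
  then have "open_angle d (Suc J) P' = open_angle d J P + turning_angle d (1 - w', k') (z', i')"
    using P by (simp add: open_angle_Suc P'_def)
  ultimately have "cis (open_angle d J P) * cis (turning_angle d (1 - w', k') (z', i')) =
      cis (turning_angle (outer_tangent r \<Phi>) (1 - z, i) (z', i'))"
    by (simp add: cis_eq_iff[symmetric] cis_mult)
  moreover have n: "norm (d z i) = 1" "norm (d w k) = 1" "norm (d z' i') = 1" "norm (d w' k') = 1"
    "norm (outer_tangent r \<Phi> z i) = 1" "norm (outer_tangent r \<Phi> z' i') = 1"
    "norm (\<tau> w k) = 1" "norm (\<tau> w' k') = 1"
    using unit TS mem norm_outer_tangent straight_tangentsD(1)[OF str] by (auto simp: Reg_def)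
  moreover have "cis (turning_angle d (1 - z, i) b) = - to_complex (d w k) / to_complex (d z i)"
    "cis (turning_angle d (1 - w', k') (z', i')) = - to_complex (d z' i') / to_complex (d w' k')"
    "cis (turning_angle (outer_tangent r \<Phi>) (1 - z, i) (z', i')) =
       - to_complex (outer_tangent r \<Phi> z' i') / to_complex (outer_tangent r \<Phi> z i)"
    using n by (simp_all only: ab(2) cis_turning_angle inv)
  ultimately have "- to_complex (d w k) / to_complex (d z i) * - to_complex (\<tau> w' k') / to_complex (\<tau> w k) *
      (- to_complex (d z' i') / to_complex (d w' k')) =
      - to_complex (outer_tangent r \<Phi> z' i') / to_complex (outer_tangent r \<Phi> z i)"
    by (simp only: ang straight_tangentsD(2)[OF str mem(8,7)] to_complex_minus)
  then show ?thesis
    using n[THEN to_complex_nonzero] by (simp add: ab fit_factor_def field_simps)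
qed

text \<open>
  Functions of the edges that are constant on the connected components.
\<close>

definition agree_at_vertices :: "(real \<times> nat) rel \<Rightarrow> nat set \<Rightarrow> (nat \<Rightarrow> 'a) \<Rightarrow> bool" where
  "agree_at_vertices r S Q \<longleftrightarrow> (\<forall>z\<in>{0, 1}. \<forall>w\<in>{0, 1}. \<forall>i\<in>S. \<forall>k\<in>S.
     vertex r z i = vertex r w k \<longrightarrow> Q i = Q k)"

lemma agree_at_verticesD:
  assumes "agree_at_vertices r S Q" "z \<in> {0, 1}" "w \<in> {0, 1}" "i \<in> S" "k \<in> S"
    and "vertex r z i = vertex r w k"
  shows "Q i = Q k"
  using assms unfolding agree_at_vertices_def by blast

lemma agree_at_vertices_subset:
  assumes "agree_at_vertices r S Q" "T \<subseteq> S"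
  shows "agree_at_vertices r T Q"
  using assms unfolding agree_at_vertices_def by blast

text \<open>
  On a component that touches regular edges, \<open>Q\<close> is the common fit factor of all contacts; on the
  other components nothing has to be adjusted and \<open>Q\<close> is the identity. At a vertex with regular edges
  the rotation required there is the one that the regular edges determine. At the other vertices it is
  the rotation of \<open>\<tau>\<close> followed by \<open>Q\<close>, which takes the same value on all edges that meet there.
\<close>

lemma extend_tangents:
  assumes unit_angles: "\<forall>z\<in>{0, 1}. \<forall>i\<in>S. norm (d z i) = 1"
    and reg_or_sing: "S = Reg r S \<Phi> \<union> Sing r S \<Phi>"
    and path: "path_angle_condition r d S \<Phi>"
    and mat: "matches_angles r d (Sing r S \<Phi>) \<tau>" and str: "straight_tangents (Sing r S \<Phi>) \<tau>"
  shows "\<exists>Q. (\<forall>i. rotation_matrix (Q i)) \<and> agree_at_vertices r (Sing r S \<Phi>) Q \<and>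
    virtual_angle_condition r d S \<Phi>
      (\<lambda>z i. if i \<in> Sing r S \<Phi> then Q i *v \<tau> z i else outer_tangent r \<Phi> z i)"
proof -
  let ?T = "Sing r S \<Phi>"
  have unit: "norm (d z i) = 1" if "z \<in> {0, 1}" "i \<in> S" for z i
    using unit_angles that by blast
  let ?reach = "(follows r ?T)\<^sup>*\<^sup>*"
  \<comment> \<open>The factors demanded by the contacts of the component of \<open>b\<close>: at most one by uniqueness.\<close>
  define C where "C b = {fit_factor r d \<Phi> \<tau> a b' | a b'. contact r S \<Phi> a b' \<and> ?reach b' b}" for b
  define \<rho> where "\<rho> i = (if C (0, i) = {} then 1 else SOME x. x \<in> C (0, i))" for i
  have C_cong: "C b = C b'" if "?reach b b'" for b b'
    using that reachable_sym[OF that] unfolding C_def by (metis rtranclp_trans)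
  have C_unique: "x = y" if "x \<in> C b" "y \<in> C b" for x y b
  proof -
    obtain a c where x: "contact r S \<Phi> a c" "?reach c b" "x = fit_factor r d \<Phi> \<tau> a c"
      using \<open>x \<in> C b\<close> unfolding C_def by blast
    obtain a' c' where y: "contact r S \<Phi> a' c'" "?reach c' b" "y = fit_factor r d \<Phi> \<tau> a' c'"
      using \<open>y \<in> C b\<close> unfolding C_def by blast
    have "?reach c c'"
      using x(2) reachable_sym[OF y(2)] by (rule rtranclp_trans)
    then show ?thesis
      unfolding x(3) y(3) using fit_factor_unique[OF unit path mat str x(1) y(1)] by blast
  qed
  have C_zero: "C (z, i) = C (0, i)" if "z \<in> {0, 1}" "i \<in> ?T" for z i
  proof (cases "z = 0")
    case False
    then have "follows r ?T (z, i) (0, i)"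
      using that follows_backtrack[of 1 i ?T r] by simp
    then show ?thesis by (intro C_cong) (rule r_into_rtranclp)
  qed simp
  have \<rho>_eq: "\<rho> i = x" if "x \<in> C (z, i)" "z \<in> {0, 1}" "i \<in> ?T" for x z i
  proof -
    have x: "x \<in> C (0, i)" using that(1) C_zero[OF that(2,3)] by simp
    then have "(SOME x. x \<in> C (0, i)) \<in> C (0, i)" by (rule someI)
    then show ?thesis using x C_unique by (auto simp: \<rho>_def)
  qed
  have \<rho>_cong: "\<rho> i = \<rho> k" if "z \<in> {0, 1}" "w \<in> {0, 1}" "i \<in> ?T" "k \<in> ?T"
    "vertex r z i = vertex r w k" for z w i k
  proof -
    have "follows r ?T (1 - z, i) (w, k)"
      using that by (rule follows_at_vertex)
    then have "C (1 - z, i) = C (w, k)" by (intro C_cong) (rule r_into_rtranclp)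
    moreover have "1 - z \<in> {0, 1}" using that(1) by auto
    ultimately have "C (0, i) = C (0, k)" using that C_zero by metis
    then show ?thesis by (simp add: \<rho>_def)
  qed
  have norm_\<rho>: "norm (\<rho> i) = 1" for i
  proof (cases "C (0, i) = {}")
    case False
    then have "\<rho> i \<in> C (0, i)" by (simp add: \<rho>_def some_in_eq)
    then show ?thesis using norm_fit_factor[OF unit str] by (auto simp: C_def)
  qed (simp add: \<rho>_def)
  define Q where "Q i = rotation_of (\<rho> i)" for i
  define \<sigma> where "\<sigma> z i = (if i \<in> ?T then Q i *v \<tau> z i else outer_tangent r \<Phi> z i)" for z i
  have Q: "rotation_matrix (Q i)" for i
    by (simp add: Q_def rotation_matrix_rotation_of norm_\<rho>)
  have "matches_angles r d S \<sigma>"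
    unfolding matches_angles_def
  proof
    fix p assume p: "p \<in> vertices r S"
    obtain R :: "real^2^2" where R: "rotation_matrix R"
      and "\<forall>z\<in>{0, 1}. \<forall>i\<in>Reg r S \<Phi>. vertex r z i = p \<longrightarrow>
           outer_tangent r \<Phi> z i = R *v d z i"
      using bspec[OF conjunct1[OF path[unfolded path_angle_condition_def]] p]
      by (elim exE conjE)
    then have Rreg: "outer_tangent r \<Phi> z i = R *v d z i"
      if "z \<in> {0, 1}" "i \<in> Reg r S \<Phi>" "vertex r z i = p" for z i
      using that by auto
    show "\<exists>R :: real^2^2. rotation_matrix R \<and>
        (\<forall>z\<in>{0, 1}. \<forall>i\<in>S. vertex r z i = p \<longrightarrow> \<sigma> z i = R *v d z i)"
    proof (cases "\<exists>z\<in>{0, 1}. \<exists>i\<in>Reg r S \<Phi>. vertex r z i = p")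
      case True
      then obtain z i where zi: "z \<in> {0, 1}" "i \<in> Reg r S \<Phi>" "vertex r z i = p" by blast
      have "Q k *v \<tau> w k = R *v d w k" if wk: "w \<in> {0, 1}" "k \<in> ?T" "vertex r w k = p" for w k
      proof -
        have "contact r S \<Phi> (z, i) (w, k)"
          using zi wk by (auto simp: contact_def start_vertex_def)
        then have "\<rho> k = fit_factor r d \<Phi> \<tau> (z, i) (w, k)"
          by (intro \<rho>_eq[OF _ wk(1,2)]) (auto simp: C_def)
        moreover have "norm (d z i) = 1" "norm (\<tau> w k) = 1"
          using zi unit straight_tangentsD(1)[OF str wk(2,1)] by (auto simp: Reg_def)
        moreover obtain c where "\<And>v. to_complex (R *v v) = c * to_complex v"
          using rotation_matrix_obtain_complex[OF R] by blast
        ultimately show ?thesis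
          by (simp add: to_complex_inject[symmetric] Q_def to_complex_rotation_of fit_factor_def
              Rreg[OF zi] to_complex_nonzero)
      qed
      then have "\<sigma> w k = R *v d w k" if "w \<in> {0, 1}" "k \<in> S" "vertex r w k = p" for w k
        using Rreg[OF that(1) _ that(3)] that reg_or_sing by (cases "k \<in> ?T") (auto simp: \<sigma>_def)
      then show ?thesis
        using R by blast
    next
      case noreg: False
      then have onlyT: "i \<in> ?T" if "z \<in> {0, 1}" "i \<in> S" "vertex r z i = p" for z i
        using that reg_or_sing by blast
      obtain w k where wk: "w \<in> {0, 1}" "k \<in> ?T" "vertex r w k = p"
        using p onlyT by (auto simp: vertices_def)
      then have "p \<in> vertices r ?T" by (auto simp: vertices_def)
      from matches_anglesD[OF mat this] obtain R' :: "real^2^2" where R': "rotation_matrix R'" and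
        RT': "\<forall>z\<in>{0, 1}. \<forall>i\<in>?T. vertex r z i = p \<longrightarrow> \<tau> z i = R' *v d z i"
        by (elim exE conjE)
      note RT = RT'[rule_format]
      have "rotation_matrix (Q k ** R')"
        using Q[of k] R' by (simp add: rotation_matrix_def orthogonal_matrix_mul det_mul)
      moreover have "\<sigma> z i = (Q k ** R') *v d z i" if "z \<in> {0, 1}" "i \<in> S" "vertex r z i = p" for z i
        using onlyT[OF that] RT[OF that(1) onlyT[OF that] that(3)]
          \<rho>_cong[OF that(1) wk(1) onlyT[OF that] wk(2)] that(3) wk(3)
        by (simp add: \<sigma>_def Q_def matrix_vector_mul_assoc)
      ultimately show ?thesis by blast
    qed
  qed
  moreover have "straight_tangents ?T \<sigma>"
  proof -
    have "norm (Q i *v v) = norm v" for i v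
      by (simp add: norm_to_complex[symmetric] Q_def to_complex_rotation_of norm_mult norm_\<rho>)
    then show ?thesis
      using str by (auto simp: straight_tangents_def \<sigma>_def matrix_vector_mult_uminus)
  qed
  moreover have "\<sigma> z i = outer_tangent r \<Phi> z i" if "i \<in> Reg r S \<Phi>" for z i
    using that regular_not_singular by (auto simp: \<sigma>_def Reg_def Sing_def)
  ultimately have "virtual_angle_condition r d S \<Phi> \<sigma>"
    by (simp add: virtual_angle_condition_iff)
  then have vir: "virtual_angle_condition r d S \<Phi>
      (\<lambda>z i. if i \<in> ?T then Q i *v \<tau> z i else outer_tangent r \<Phi> z i)"
    unfolding \<sigma>_def .
  have "agree_at_vertices r ?T Q"
    unfolding agree_at_vertices_def Q_def
  proof (intro ballI impI)
    show "rotation_of (\<rho> i) = rotation_of (\<rho> k)"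
      if "z \<in> {0, 1}" "w \<in> {0, 1}" "i \<in> ?T" "k \<in> ?T" "vertex r z i = vertex r w k" for z w i k
      by (simp only: \<rho>_cong[OF that])
  qed
  then show ?thesis
    using Q vir by (intro exI[of _ Q] conjI allI)
qed


section \<open>Rotating curves\<close>

lemma rotated_curve_derivative:
  fixes R :: "real^2^2"
  assumes "\<And>t. t \<in> {0..1} \<Longrightarrow> \<gamma>' t = R *v \<gamma> t" "\<gamma> differentiable (at t within {0..1})" "t \<in> {0..1}"
  shows "\<gamma>' differentiable (at t within {0..1})" "velocity \<gamma>' t = R *v velocity \<gamma> t"
proof -
  have "(\<gamma> has_vector_derivative velocity \<gamma> t) (at t within {0..1})"
    using assms(2) by (simp add: vector_derivative_works)
  then have "((\<lambda>t. R *v \<gamma> t) has_vector_derivative R *v velocity \<gamma> t) (at t within {0..1})"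
    by (rule bounded_linear.has_vector_derivative[OF matrix_vector_mul_bounded_linear])
  then have "(\<gamma>' has_vector_derivative R *v velocity \<gamma> t) (at t within {0..1})"
    using has_vector_derivative_transform[of t "{0..1}" \<gamma>' "\<lambda>t. R *v \<gamma> t"] assms by blast
  then show "\<gamma>' differentiable (at t within {0..1})" "velocity \<gamma>' t = R *v velocity \<gamma> t"
    using assms(3) velocity_eqI by (auto simp: differentiableI_vector)
qed

lemma rotation_matrix_inverse:
  fixes R :: "real^2^2"
  assumes "rotation_matrix R"
  obtains R' :: "real^2^2" where "rotation_matrix R'" "\<And>v. R' *v (R *v v) = v"
proof
  show "rotation_matrix (transpose R)"
    using assms by (simp add: rotation_matrix_def orthogonal_matrix_transpose)
  have "transpose R ** R = mat 1"
    using assms by (simp add: rotation_matrix_def orthogonal_matrix_def)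
  then show "transpose R *v (R *v v) = v" for v
    by (simp only: matrix_vector_mul_assoc matrix_vector_mul_lid)
qed

text \<open>
  Invertibility of the rotation makes this hold for every \<open>f\<close>, with the default value 0 on both sides
  when the integral does not exist, so that no integrability of products with test functions has
  to be established.
\<close>

lemma integral_rotation:
  fixes R :: "real^2^2" and f :: "'a \<Rightarrow> real^2"
  assumes "rotation_matrix R"
  shows "integral\<^sup>L M (\<lambda>x. R *v f x) = R *v integral\<^sup>L M f"
proof -
  obtain R' :: "real^2^2" where "\<And>v. R' *v (R *v v) = v"
    using rotation_matrix_inverse[OF assms] by blast
  then show ?thesis
    by (intro integral_bounded_linear'[where T' = "\<lambda>v. R' *v v"])
      (simp_all add: matrix_vector_mul_bounded_linear)
qed

lemma square_integrable_rotated: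
  fixes R :: "real^2^2"
  assumes "rotation_matrix R" "\<And>t. t \<in> {0<..<1} \<Longrightarrow> g t = R *v f t" "square_integrable f"
  shows "square_integrable g"
proof -
  have ind: "indicator {0<..<1} t *\<^sub>R g t = R *v (indicator {0<..<1} t *\<^sub>R f t)" for t :: real
    using assms(2)[of t] by (cases "t \<in> {0<..<1}") auto
  have "set_borel_measurable lebesgue {0<..<1} f"
    using assms(3) by (simp add: square_integrable_def)
  then have "(\<lambda>t. R *v (indicator {0<..<1} t *\<^sub>R f t)) \<in> borel_measurable lebesgue"
    unfolding set_borel_measurable_def
    by (rule borel_measurable_continuous_on[OF matrix_vector_mult_linear_continuous_on[of UNIV R]])
  then have "set_borel_measurable lebesgue {0<..<1} g"
    unfolding set_borel_measurable_def ind .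
  moreover have ns: "indicat_real {0<..<1} t *\<^sub>R (norm (g t))\<^sup>2 = indicat_real {0<..<1} t *\<^sub>R (norm (f t))\<^sup>2" for t
    using assms(2)[of t] norm_rotation[OF assms(1)] by (cases "t \<in> {0<..<1}") auto
  have "set_integrable lebesgue {0<..<1} (\<lambda>t. (norm (g t))\<^sup>2)"
    using assms(3) unfolding square_integrable_def set_integrable_def ns by blast
  ultimately show ?thesis by (simp add: square_integrable_def)
qed

lemma weak_derivative_rotated:
  fixes R :: "real^2^2"
  assumes "rotation_matrix R" "\<And>t. t \<in> {0<..<1} \<Longrightarrow> f' t = R *v f t"
    and "\<And>t. t \<in> {0<..<1} \<Longrightarrow> g' t = R *v g t" "weak_derivative f g"
  shows "weak_derivative f' g'"
proof -
  have int: "(LINT t:{0<..<1}|lebesgue. \<psi> t *\<^sub>R h' t) = R *v (LINT t:{0<..<1}|lebesgue. \<psi> t *\<^sub>R h t)"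
    if "\<And>t. t \<in> {0<..<1} \<Longrightarrow> h' t = R *v h t" for \<psi> :: "real \<Rightarrow> real" and h h' :: "real \<Rightarrow> real^2"
  proof -
    have "indicat_real {0<..<1} t *\<^sub>R \<psi> t *\<^sub>R h' t = R *v (indicat_real {0<..<1} t *\<^sub>R \<psi> t *\<^sub>R h t)" for t
      using that[of t] by (cases "t \<in> {0<..<1}") (auto simp: matrix_vector_mult_scaleR)
    then show ?thesis
      unfolding set_lebesgue_integral_def by (simp only: integral_rotation[OF assms(1)])
  qed
  show ?thesis
    unfolding weak_derivative_def
  proof (intro allI impI)
    fix \<phi> assume "test_function \<phi>"
    then have "(LINT t:{0<..<1}|lebesgue. deriv \<phi> t *\<^sub>R f t) = - (LINT t:{0<..<1}|lebesgue. \<phi> t *\<^sub>R g t)"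
      using assms(4) by (simp add: weak_derivative_def)
    then show "(LINT t:{0<..<1}|lebesgue. deriv \<phi> t *\<^sub>R f' t) = - (LINT t:{0<..<1}|lebesgue. \<phi> t *\<^sub>R g' t)"
      using int[where \<psi> = "deriv \<phi>", OF assms(2)] int[where \<psi> = \<phi>, OF assms(3)]
      by (simp only: matrix_vector_mult_uminus)
  qed
qed

lemma regular_curve_rotated:
  fixes R :: "real^2^2"
  assumes R: "rotation_matrix R" and eq: "\<And>t. t \<in> {0..1} \<Longrightarrow> \<gamma>' t = R *v \<gamma> t"
    and reg: "regular_curve \<gamma>"
  shows "regular_curve \<gamma>'"
proof -
  have imm: "immersion \<gamma>" using reg by (simp add: regular_curve_def)
  have vel: "\<gamma>' differentiable (at t within {0..1})" "velocity \<gamma>' t = R *v velocity \<gamma> t"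
    "velocity \<gamma> t \<noteq> 0"
    if "t \<in> {0..1}" for t
    using rotated_curve_derivative[OF eq] imm that by (auto simp: immersion_def)
  have "continuous_on {0..1} (\<lambda>t. R *v velocity \<gamma> t)"
    using imm by (intro continuous_on_compose2[OF matrix_vector_mult_linear_continuous_on[of UNIV R]])
      (auto simp: immersion_def)
  moreover have "continuous_on {0..1} (velocity \<gamma>') \<longleftrightarrow> continuous_on {0..1} (\<lambda>t. R *v velocity \<gamma> t)"
    by (intro continuous_on_cong refl vel(2))
  ultimately have "continuous_on {0..1} (velocity \<gamma>')"
    by (rule iffD2[rotated])
  moreover have "R *v velocity \<gamma> t \<noteq> 0" if "t \<in> {0..1}" for t
    using norm_rotation[OF R, of "velocity \<gamma> t"] vel(3)[OF that] by auto
  ultimately have "immersion \<gamma>'"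
    using vel(1,2) by (simp add: immersion_def)
  moreover have "class_H2 \<gamma>'"
  proof -
    obtain g h where gh: "square_integrable \<gamma>" "square_integrable g" "square_integrable h"
      "weak_derivative \<gamma> g" "weak_derivative g h"
      using reg by (auto simp: regular_curve_def class_H2_def)
    have eq': "\<gamma>' t = R *v \<gamma> t" if "t \<in> {0<..<1}" for t
      using eq that by simp
    show ?thesis
      unfolding class_H2_def
      using square_integrable_rotated[OF R eq' gh(1)]
        square_integrable_rotated[OF R refl gh(2)] square_integrable_rotated[OF R refl gh(3)]
        weak_derivative_rotated[OF R eq' refl gh(4)] weak_derivative_rotated[OF R refl refl gh(5)]
      by blast
  qed
  ultimately show ?thesis by (simp add: regular_curve_def)
qed

lemma regular_curve_rotated_iff:
  fixes R :: "real^2^2"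
  assumes "rotation_matrix R" "\<And>t. t \<in> {0..1} \<Longrightarrow> \<gamma>' t = R *v \<gamma> t"
  shows "regular_curve \<gamma>' \<longleftrightarrow> regular_curve \<gamma>"
proof -
  obtain R' :: "real^2^2" where R': "rotation_matrix R'" "\<And>v. R' *v (R *v v) = v"
    using rotation_matrix_inverse[OF assms(1)] by blast
  then have "\<gamma> t = R' *v \<gamma>' t" if "t \<in> {0..1}" for t
    by (simp add: assms(2)[OF that])
  then show ?thesis
    using regular_curve_rotated[of R \<gamma>' \<gamma>] regular_curve_rotated[of R' \<gamma> \<gamma>']
      R'(1) assms by blast
qed

lemma singular_curve_rotated_iff:
  fixes R :: "real^2^2"
  assumes "rotation_matrix R" "\<And>t. t \<in> {0..1} \<Longrightarrow> \<gamma>' t = R *v \<gamma> t"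
  shows "singular_curve \<gamma>' \<longleftrightarrow> singular_curve \<gamma>"
proof -
  obtain R' :: "real^2^2" where R': "rotation_matrix R'" "\<And>v. R' *v (R *v v) = v"
    using rotation_matrix_inverse[OF assms(1)] by blast
  then have "\<gamma> t = R' *v \<gamma>' t" if "t \<in> {0..1}" for t
    by (simp add: assms(2)[OF that])
  with assms(2) show ?thesis
    unfolding singular_curve_def constant_on_def by metis
qed

lemma straight_segment_rotated:
  fixes R :: "real^2^2"
  assumes "\<And>t. t \<in> {0..1} \<Longrightarrow> \<gamma>' t = R *v \<gamma> t" "straight_segment \<gamma>"
  shows "straight_segment \<gamma>'"
proof -
  have "\<gamma>' ` {0..1} = (*v) R ` (\<gamma> ` {0..1})"
    using assms(1) by (force simp: image_image)
  also have "\<dots> = closed_segment (R *v \<gamma> 0) (R *v \<gamma> 1)"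
    using assms(2) by (simp add: straight_segment_def closed_segment_linear_image)
  finally show ?thesis
    using assms(1) by (simp add: straight_segment_def)
qed

lemma straight_segment_constant:
  assumes "singular_curve \<gamma>"
  shows "straight_segment \<gamma>"
proof -
  obtain c where "\<And>t. t \<in> {0..1} \<Longrightarrow> \<gamma> t = c"
    using assms by (auto simp: singular_curve_def constant_on_def)
  then have "\<gamma> ` {0..1} = {c}" "\<gamma> 0 = c" "\<gamma> 1 = c" by force+
  then show ?thesis by (simp add: straight_segment_def)
qed


section \<open>Rotating networks componentwise\<close>

lemma topspace_graph_topology: "topspace (graph_topology N r) = edge_space N // r"
proof -
  have "topspace (graph_topology N r) = proj r ` edge_space N"
    using quotient_map_proj[of N r] by (simp add: quotient_map_def)
  then show ?thesis by (auto simp: proj_def quotient_def)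
qed

text \<open>
  Hence a function with \<open>agree_at_vertices\<close> defines a function of the points of the subgraph.
\<close>

lemma edges_meet_at_vertices:
  assumes "N_graph N r" "i \<in> {1..N}" "k \<in> {1..N}" "x \<in> edge r i" "x \<in> edge r k" "i \<noteq> k"
  shows "\<exists>z\<in>{0, 1}. \<exists>w\<in>{0, 1}. vertex r z i = vertex r w k"
proof -
  obtain s t where st: "s \<in> {0..1}" "t \<in> {0..1}" "x = proj r (s, i)" "x = proj r (t, k)"
    using assms(4,5) by (auto simp: edge_def)
  have "equiv (edge_space N) r"
    using assms(1) by (simp add: N_graph_def)
  moreover have "(s, i) \<in> edge_space N" "(t, k) \<in> edge_space N"
    using st assms(2,3) by (auto simp: edge_space_def)
  ultimately have "((s, i), (t, k)) \<in> r"
    using st(3,4) eq_equiv_class_iff[of "edge_space N" r "(s, i)" "(t, k)"] by (simp add: proj_def)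
  then have "s \<in> {0, 1}" "t \<in> {0, 1}"
    using assms(1,6) by (auto simp: N_graph_def endpoints_def)
  then obtain z w :: nat where "z \<in> {0, 1}" "w \<in> {0, 1}" "s = real z" "t = real w"
    by (metis insertCI insertE of_nat_0 of_nat_1 singletonD)
  then show ?thesis
    using st(3,4) by (auto simp: vertex_def)
qed

text \<open>
  The preimage of an edge in the disjoint union consists of the interval itself and of endpoints of other
  intervals, and these are finitely many.
\<close>

lemma closedin_edge:
  assumes "N_graph N r" "i \<in> {1..N}"
  shows "closedin (graph_topology N r) (edge r i)"
proof -
  have eqv: "equiv (edge_space N) r"
    using assms(1) by (simp add: N_graph_def)
  let ?A = "{x \<in> edge_space N. proj r x \<in> edge r i}"
  define B where "B = {x \<in> ?A. x \<in> endpoints N}"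
  have I: "{0..1} \<times> {i} \<subseteq> edge_space N"
    using assms(2) by (auto simp: edge_space_def)
  have "?A = {0..1} \<times> {i} \<union> B"
  proof (intro equalityI subsetI)
    fix x assume x: "x \<in> ?A"
    then obtain t where t: "t \<in> {0..1}" "proj r x = proj r (t, i)" by (auto simp: edge_def)
    then have "(t, i) \<in> edge_space N" using I by auto
    then have "(x, (t, i)) \<in> r"
      using t(2) x eq_equiv_class_iff[OF eqv, of x "(t, i)"] by (auto simp: proj_def)
    then have "x = (t, i) \<or> x \<in> endpoints N"
      using assms(1) by (auto simp: N_graph_def)
    then show "x \<in> {0..1} \<times> {i} \<union> B" using t(1) x by (auto simp: B_def)
  qed (use I in \<open>auto simp: edge_def B_def\<close>)
  moreover have "finite (endpoints N)" by (simp add: endpoints_def)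
  then have "closed B" by (intro finite_imp_closed) (simp add: B_def)
  then have "closed ({0..1} \<times> {i} \<union> B)"
    by (intro closed_Un closed_Times) auto
  ultimately have "closed ?A" by simp
  then have "closedin (top_of_set (edge_space N)) ?A"
    by (simp add: closed_subset)
  moreover have "edge r i \<subseteq> topspace (graph_topology N r)"
    using I by (auto simp: topspace_graph_topology edge_def proj_def quotient_def)
  ultimately show ?thesis
    using quotient_map_proj[of N r] unfolding quotient_map_closedin by simp
qed

text \<open>
  The edges form a finite closed cover of the subgraph, so continuity of the rotated map follows by pasting.
\<close>

lemma network_rotated:
  fixes Q :: "nat \<Rightarrow> real^2^2"
  assumes graph: "N_graph N r" and net: "network N r S \<Phi>"
    and Q: "\<And>i. i \<in> S \<Longrightarrow> rotation_matrix (Q i)"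
    and \<Phi>': "\<And>i x. i \<in> S \<Longrightarrow> x \<in> edge r i \<Longrightarrow> \<Phi>' x = Q i *v \<Phi> x"
  shows "network N r S \<Phi>'"
  unfolding network_def
proof (intro conjI ballI)
  show "S \<subseteq> {1..N}" using net by (simp add: network_def)
  let ?X = "subtopology (graph_topology N r) (subgraph_points r S)"
  show "continuous_map ?X euclidean \<Phi>'"
  proof (rule pasting_lemma_closed[where I = S and T = "edge r" and f = "\<lambda>i x. Q i *v \<Phi> x"])
    show "finite S" using \<open>S \<subseteq> {1..N}\<close> finite_subset by blast
    show "closedin ?X (edge r i)" if "i \<in> S" for i
      using that closedin_edge[OF graph] \<open>S \<subseteq> {1..N}\<close>
      by (intro closedin_subset_topspace) (auto simp: subgraph_points_def)
    show "continuous_map (subtopology ?X (edge r i)) euclidean (\<lambda>x. Q i *v \<Phi> x)" for i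
    proof -
      have "continuous_map ?X euclidean \<Phi>" using net by (simp add: network_def)
      moreover have "continuous_map euclidean euclidean ((*v) (Q i))"
        using matrix_vector_mult_linear_continuous_on[of UNIV "Q i"] by simp
      ultimately have "continuous_map ?X euclidean ((*v) (Q i) \<circ> \<Phi>)"
        by (rule continuous_map_compose)
      then show ?thesis
        by (simp add: continuous_map_from_subtopology o_def)
    qed
    show "Q i *v \<Phi> x = Q j *v \<Phi> x" if "i \<in> S" "j \<in> S" "x \<in> topspace ?X \<inter> edge r i \<inter> edge r j" for i j x
      using that \<Phi>' by (metis IntE)
    show "\<exists>j. j \<in> S \<and> x \<in> edge r j \<and> \<Phi>' x = Q j *v \<Phi> x" if "x \<in> topspace ?X" for x
      using that \<Phi>' by (auto simp: subgraph_points_def)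
  qed
  fix i assume "i \<in> S"
  then have "curve r \<Phi>' i t = Q i *v curve r \<Phi> i t" if "t \<in> {0..1}" for t
    using that \<Phi>' by (auto simp: curve_def edge_def)
  then show "singular_curve (curve r \<Phi>' i) \<or> regular_curve (curve r \<Phi>' i)"
    using net \<open>i \<in> S\<close> Q regular_curve_rotated_iff singular_curve_rotated_iff
    unfolding network_def by blast
qed


section \<open>Stratifications\<close>

text \<open>
  The chains of subgraphs in both notions of straightness arise by iterating the singular part. The
  inductive form allows arguments on strata to proceed by induction from the last stratum, and
  is parametrised by the property \<open>good\<close> of a stratum in order to cover both notions.
\<close>

inductive stratified ::
  "(nat set \<Rightarrow> graph_map \<Rightarrow> bool) \<Rightarrow> (real \<times> nat) rel \<Rightarrow> nat set \<Rightarrow> bool"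
  for good r where
  empty: "stratified good r {}"
| step: "good S \<Phi> \<Longrightarrow> Sing r S \<Phi> \<subset> S \<Longrightarrow> stratified good r (Sing r S \<Phi>) \<Longrightarrow> stratified good r S"

lemma stratified_mono:
  assumes "stratified good r S" "\<And>S \<Phi>. good S \<Phi> \<Longrightarrow> good' S \<Phi>"
  shows "stratified good' r S"
  using assms(1) by induction (auto intro: stratified.intros assms(2))

lemma stratified_iff_chain:
  "stratified good r S \<longleftrightarrow>
     (\<exists>q H \<Sigma>. H 0 = S \<and> H q = {} \<and> (\<forall>j<q. H (Suc j) \<subset> H j) \<and>
        (\<forall>j<q. good (H j) (\<Sigma> j) \<and> H (Suc j) = Sing r (H j) (\<Sigma> j)))"
  (is "_ \<longleftrightarrow> (\<exists>q H \<Sigma>. ?chain S q H \<Sigma>)")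
proof
  assume "stratified good r S"
  then show "\<exists>q H \<Sigma>. ?chain S q H \<Sigma>"
  proof induction
    case empty
    show ?case
      by (intro exI[of _ 0] exI[of _ "\<lambda>_. {}"]) simp
  next
    case (step S \<Phi>)
    from step.IH obtain q H \<Sigma> where chain: "?chain (Sing r S \<Phi>) q H \<Sigma>"
      by (elim exE)
    have "?chain S (Suc q) (case_nat S H) (case_nat \<Phi> \<Sigma>)"
      unfolding All_less_Suc2 nat.case using chain step.hyps by blast
    then show ?case
      by (intro exI)
  qed
next
  assume "\<exists>q H \<Sigma>. ?chain S q H \<Sigma>"
  then obtain q H \<Sigma> where "?chain S q H \<Sigma>"
    by (elim exE)
  then show "stratified good r S"
  proof (induction q arbitrary: S H \<Sigma>)
    case 0
    then show ?case by (auto intro: stratified.empty)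
  next
    case (Suc q)
    note prems = Suc.prems[unfolded All_less_Suc2]
    have "?chain (H 1) q (\<lambda>j. H (Suc j)) (\<lambda>j. \<Sigma> (Suc j))"
      unfolding One_nat_def using prems by blast
    then have "stratified good r (H 1)"
      by (rule Suc.IH)
    moreover have "good S (\<Sigma> 0)" "H 1 = Sing r S (\<Sigma> 0)" "H 1 \<subset> S"
      unfolding One_nat_def using prems by blast+
    ultimately show ?case
      by (metis stratified.step)
  qed
qed

definition V_stratum ::
  "nat \<Rightarrow> (real \<times> nat) rel \<Rightarrow> (nat \<Rightarrow> nat \<Rightarrow> real^2) \<Rightarrow> (nat \<Rightarrow> nat \<Rightarrow> real^2) \<Rightarrow>
     nat set \<Rightarrow> graph_map \<Rightarrow> bool" where
  "V_stratum N r d \<tau> S \<Phi> \<longleftrightarrow> network N r S \<Phi> \<and> virtual_angle_condition r d S \<Phi> \<tau> \<and>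
     (\<forall>i\<in>Reg r S \<Phi>. straight_segment (curve r \<Phi> i))"

definition P_stratum ::
  "nat \<Rightarrow> (real \<times> nat) rel \<Rightarrow> (nat \<Rightarrow> nat \<Rightarrow> real^2) \<Rightarrow> nat set \<Rightarrow> graph_map \<Rightarrow> bool" where
  "P_stratum N r d S \<Phi> \<longleftrightarrow> network N r S \<Phi> \<and> path_angle_condition r d S \<Phi> \<and>
     (\<forall>i\<in>S. straight_segment (curve r \<Phi> i))"

lemma V_stratified_straight_iff:
  "V_stratified_straight N r d S \<tau> \<longleftrightarrow> S \<subseteq> {1..N} \<and> stratified (V_stratum N r d \<tau>) r S"
  by (simp add: V_stratified_straight_def stratified_iff_chain V_stratum_def conj_assoc)

lemma P_stratified_straight_iff:
  "P_stratified_straight N r d S \<longleftrightarrow> S \<subseteq> {1..N} \<and> stratified (P_stratum N r d) r S"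
  by (simp add: P_stratified_straight_def stratified_iff_chain P_stratum_def conj_assoc)


section \<open>Rotating stratified networks\<close>

text \<open>
  The rotated map is defined on points, through an arbitrary choice of an edge that contains the
  point. Edges that share a point share a vertex, hence the choice does not affect the value of \<open>Q\<close>.
\<close>

lemma V_stratum_rotated:
  fixes Q :: "nat \<Rightarrow> real^2^2"
  assumes graph: "N_graph N r" and V: "V_stratum N r d \<tau> S \<Phi>"
    and Q: "\<And>i. rotation_matrix (Q i)"
    and agree: "agree_at_vertices r S Q"
    and \<tau>': "\<And>z i. i \<in> S \<Longrightarrow> \<tau>' z i = Q i *v \<tau> z i"
  shows "\<exists>\<Phi>'. V_stratum N r d \<tau>' S \<Phi>' \<and> Sing r S \<Phi>' = Sing r S \<Phi>"
proof -
  have net: "network N r S \<Phi>"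
    and real: "\<And>i z. i \<in> Reg r S \<Phi> \<Longrightarrow> z \<in> {0, 1} \<Longrightarrow> \<tau> z i = outer_tangent r \<Phi> z i"
    and virt: "straight_tangents (Sing r S \<Phi>) \<tau>" and mat: "matches_angles r d S \<tau>"
    and str: "\<And>i. i \<in> Reg r S \<Phi> \<Longrightarrow> straight_segment (curve r \<Phi> i)"
    using V by (auto simp: V_stratum_def virtual_angle_condition_iff)
  have SN: "S \<subseteq> {1..N}" using net by (simp add: network_def)
  define \<Phi>' where "\<Phi>' x = Q (SOME i. i \<in> S \<and> x \<in> edge r i) *v \<Phi> x" for x
  have eq: "\<Phi>' x = Q i *v \<Phi> x" if "i \<in> S" "x \<in> edge r i" for i x
  proof -
    define k where "k = (SOME i. i \<in> S \<and> x \<in> edge r i)"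
    have k: "k \<in> S" "x \<in> edge r k"
      using someI[of "\<lambda>i. i \<in> S \<and> x \<in> edge r i" i] that by (auto simp: k_def)
    have "Q k = Q i"
    proof (cases "k = i")
      case False
      with edges_meet_at_vertices[OF graph _ _ k(2) that(2)] k(1) that(1) SN
      obtain z w where "z \<in> {0, 1}" "w \<in> {0, 1}" "vertex r z k = vertex r w i" by blast
      then show ?thesis
        by (rule agree_at_verticesD[OF agree _ _ k(1) that(1)])
    qed simp
    then show ?thesis by (simp add: \<Phi>'_def k_def)
  qed
  have curve: "curve r \<Phi>' i t = Q i *v curve r \<Phi> i t" if "i \<in> S" "t \<in> {0..1}" for i t
    using that eq by (auto simp: curve_def edge_def)
  have Reg': "Reg r S \<Phi>' = Reg r S \<Phi>"
    using regular_curve_rotated_iff[OF Q curve] unfolding Reg_def by auto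
  have Sing': "Sing r S \<Phi>' = Sing r S \<Phi>"
    using singular_curve_rotated_iff[OF Q curve] unfolding Sing_def by auto
  have "straight_tangents (Sing r S \<Phi>) \<tau>'"
    using virt unfolding straight_tangents_def
    by (simp add: Sing_def \<tau>' norm_rotation[OF Q] matrix_vector_mult_uminus)
  moreover have "\<tau>' z i = outer_tangent r \<Phi>' z i" if i: "i \<in> Reg r S \<Phi>" and z: "z \<in> {0, 1}" for i z
  proof -
    have iS: "i \<in> S" and "regular_curve (curve r \<Phi> i)" using i by (auto simp: Reg_def)
    moreover have z01: "real z \<in> {0..1}" using z by auto
    ultimately have "curve r \<Phi> i differentiable (at (real z) within {0..1})"
      by (simp add: regular_curve_def immersion_def)
    then have v: "velocity (curve r \<Phi>' i) (real z) = Q i *v velocity (curve r \<Phi> i) (real z)"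
      using z01 by (intro rotated_curve_derivative(2) curve[OF iS])
    have "\<tau>' z i = Q i *v outer_tangent r \<Phi> z i"
      by (simp only: \<tau>'[OF iS] real[OF i z])
    then show ?thesis
      by (simp add: outer_tangent_def v norm_rotation[OF Q] matrix_vector_mult_scaleR)
  qed
  moreover have "matches_angles r d S \<tau>'"
    unfolding matches_angles_def
  proof
    fix p assume p: "p \<in> vertices r S"
    then obtain w k where wk: "w \<in> {0, 1}" "k \<in> S" "p = vertex r w k"
      by (auto simp: vertices_def)
    from matches_anglesD[OF mat p] obtain R :: "real^2^2" where R: "rotation_matrix R"
      and mat_p: "\<forall>z\<in>{0, 1}. \<forall>i\<in>S. vertex r z i = p \<longrightarrow> \<tau> z i = R *v d z i"
      by (elim exE conjE)
    have "rotation_matrix (Q k ** R)"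
      using Q[of k] R by (simp add: rotation_matrix_def orthogonal_matrix_mul det_mul)
    moreover have "\<tau>' z i = (Q k ** R) *v d z i" if "z \<in> {0, 1}" "i \<in> S" "vertex r z i = p" for z i
    proof -
      have "Q i = Q k"
        using that(3) wk(3) by (intro agree_at_verticesD[OF agree that(1) wk(1) that(2) wk(2)]) simp
      then show ?thesis
        by (simp only: \<tau>'[OF that(2)] mat_p[rule_format, OF that] matrix_vector_mul_assoc)
    qed
    ultimately show "\<exists>R :: real^2^2. rotation_matrix R \<and>
        (\<forall>z\<in>{0, 1}. \<forall>i\<in>S. vertex r z i = p \<longrightarrow> \<tau>' z i = R *v d z i)"
      by (intro exI[of _ "Q k ** R"] conjI ballI impI)
  qed
  ultimately have "virtual_angle_condition r d S \<Phi>' \<tau>'"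
    by (simp add: virtual_angle_condition_iff Reg' Sing')
  moreover have "network N r S \<Phi>'"
    by (rule network_rotated[OF graph net Q eq])
  moreover have "straight_segment (curve r \<Phi>' i)" if "i \<in> Reg r S \<Phi>" for i
  proof -
    have "i \<in> S" using that by (simp add: Reg_def)
    then show ?thesis
      using str[OF that] by (intro straight_segment_rotated[OF curve])
  qed
  ultimately have "V_stratum N r d \<tau>' S \<Phi>'"
    by (simp add: V_stratum_def Reg')
  then show ?thesis using Sing' by blast
qed

text \<open>
  The same \<open>Q\<close> serves for all strata: a component of a deeper stratum lies in a component of \<open>S\<close>, so
  \<open>Q\<close> is constant on it as well.
\<close>

lemma stratified_rotated:
  fixes Q :: "nat \<Rightarrow> real^2^2"
  assumes "N_graph N r" and "stratified (V_stratum N r d \<tau>) r S"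
    and "\<And>i. rotation_matrix (Q i)"
    and "agree_at_vertices r S Q"
    and "\<And>z i. i \<in> S \<Longrightarrow> \<tau>' z i = Q i *v \<tau> z i"
  shows "stratified (V_stratum N r d \<tau>') r S"
  using assms(2,4,5)
proof (induction rule: stratified.induct)
  case empty
  show ?case by (rule stratified.empty)
next
  case (step S \<Phi>)
  obtain \<Phi>' where \<Phi>': "V_stratum N r d \<tau>' S \<Phi>'" "Sing r S \<Phi>' = Sing r S \<Phi>"
    using V_stratum_rotated[OF assms(1) step.hyps(1) assms(3) step.prems(1), of \<tau>'] step.prems(2)
    by blast
  have sub: "Sing r S \<Phi> \<subseteq> S" by (auto simp: Sing_def)
  have "stratified (V_stratum N r d \<tau>') r (Sing r S \<Phi>)"
    using step.prems sub by (intro step.IH agree_at_vertices_subset[OF step.prems(1)]) auto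
  with \<Phi>' step.hyps(2) show ?case
    by (metis stratified.step)
qed


section \<open>Assembling virtual tangents from the last stratum upwards\<close>

text \<open>
  Induction from the last stratum, whose curves are all regular and provide real tangents. In the step,
  the tangents \<open>\<tau>\<close> found on the singular part of \<open>S\<close> are rotated to fit the real tangents on \<open>S\<close>, and the
  deeper strata are rotated accordingly. That the new tangents are again opposite at the two ends of
  each edge makes them virtual tangents for the stratum above.
\<close>

lemma P_stratified_imp_V_stratified:
  assumes "N_graph N r" "assigned_angles N d" and "stratified (P_stratum N r d) r S"
  shows "\<exists>\<tau>. straight_tangents S \<tau> \<and> matches_angles r d S \<tau> \<and> stratified (V_stratum N r d \<tau>) r S"
  using assms(3)
proof induction
  case empty
  show ?case
    by (auto simp: straight_tangents_def matches_angles_def vertices_def intro: stratified.empty)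
next
  case (step S \<Phi>)
  let ?T = "Sing r S \<Phi>"
  from step.IH obtain \<tau> where \<tau>: "straight_tangents ?T \<tau>" "matches_angles r d ?T \<tau>"
    "stratified (V_stratum N r d \<tau>) r ?T"
    by (elim exE conjE)
  have net: "network N r S \<Phi>" and path: "path_angle_condition r d S \<Phi>"
    and str: "\<And>i. i \<in> S \<Longrightarrow> straight_segment (curve r \<Phi> i)"
    using step.hyps(1) by (simp_all add: P_stratum_def)
  have "S \<subseteq> {1..N}" using net by (simp add: network_def)
  then have unit: "\<forall>z\<in>{0, 1}. \<forall>i\<in>S. norm (d z i) = 1"
    using assms(2) unfolding assigned_angles_def by blast
  obtain Q where Q: "\<forall>i. rotation_matrix (Q i)"
    and agree: "agree_at_vertices r ?T Q"
    and vir: "virtual_angle_condition r d S \<Phi>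
      (\<lambda>z i. if i \<in> ?T then Q i *v \<tau> z i else outer_tangent r \<Phi> z i)"
    using extend_tangents[OF unit network_Reg_Sing[OF net] path \<tau>(2,1)] by (elim exE conjE)
  define \<sigma> where "\<sigma> = (\<lambda>z i. if i \<in> ?T then Q i *v \<tau> z i else outer_tangent r \<Phi> z i)"
  note vir = vir[folded \<sigma>_def]
  have "stratified (V_stratum N r d \<sigma>) r ?T"
    by (rule stratified_rotated[OF assms(1) \<tau>(3) Q[rule_format] agree]) (auto simp: \<sigma>_def)
  moreover have "V_stratum N r d \<sigma> S \<Phi>"
    using net vir str by (simp add: V_stratum_def Reg_def)
  ultimately have "stratified (V_stratum N r d \<sigma>) r S"
    using step.hyps(2) by (metis stratified.step)
  moreover have "straight_tangents S \<sigma>"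
    unfolding straight_tangents_def
  proof
    fix i assume i: "i \<in> S"
    show "norm (\<sigma> 0 i) = 1 \<and> norm (\<sigma> 1 i) = 1 \<and> \<sigma> 0 i = - \<sigma> 1 i"
    proof (cases "i \<in> ?T")
      case True
      then show ?thesis
        using vir unfolding virtual_angle_condition_iff straight_tangents_def by blast
    next
      case False
      with i network_Reg_Sing[OF net] have "regular_curve (curve r \<Phi> i)"
        by (auto simp: Reg_def)
      then show ?thesis
        using straight_segment_outer_tangents[OF _ str[OF i]] norm_outer_tangent False
        by (simp add: \<sigma>_def)
    qed
  qed
  moreover have "matches_angles r d S \<sigma>"
    using vir by (simp add: virtual_angle_condition_iff)
  ultimately show ?case by blast
qed


section \<open>Equivalence of the two notions\<close>

theorem corollary6p9:
  fixes N :: nat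
    and r :: "(real \<times> nat) rel"
    and d :: "nat \<Rightarrow> nat \<Rightarrow> real^2"
    and \<Gamma> :: "(real \<times> nat) set \<Rightarrow> real^2"
  assumes "N_graph N r"
    and "assigned_angles N d"
    and "network N r {1..N} \<Gamma>"
  shows "V_degenerate N r d \<Gamma> \<longleftrightarrow> P_degenerate N r d \<Gamma>"
proof
  have unit: "norm (d z i) = 1" if "z \<in> {0, 1}" "i \<in> {1..N}" for z i
    using assms(2) that unfolding assigned_angles_def by blast
  have sub: "Sing r {1..N} \<Gamma> \<subseteq> {1..N}" by (auto simp: Sing_def)
  {
    assume "V_degenerate N r d \<Gamma>"
    then obtain \<tau> where vir: "virtual_angle_condition r d {1..N} \<Gamma> \<tau>"
      and strat: "stratified (V_stratum N r d \<tau>) r (Sing r {1..N} \<Gamma>)"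
      unfolding V_degenerate_def V_stratified_straight_iff by (elim exE conjE)
    have "stratified (P_stratum N r d) r (Sing r {1..N} \<Gamma>)"
    proof (rule stratified_mono[OF strat])
      fix S \<Phi> assume V: "V_stratum N r d \<tau> S \<Phi>"
      then have net: "network N r S \<Phi>" by (simp add: V_stratum_def)
      then have "S \<subseteq> {1..N}" by (simp add: network_def)
      then have "path_angle_condition r d S \<Phi>"
        using V unit unfolding V_stratum_def by (intro virtual_imp_path_angle_condition) auto
      moreover have "straight_segment (curve r \<Phi> i)" if "i \<in> S" for i
        using network_Reg_Sing[OF net] that V straight_segment_constant
        unfolding V_stratum_def Sing_def by blast
      ultimately show "P_stratum N r d S \<Phi>"
        using net by (simp add: P_stratum_def)
    qed
    then show "P_degenerate N r d \<Gamma>"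
      using virtual_imp_path_angle_condition[OF unit vir] sub
      by (simp add: P_degenerate_def P_stratified_straight_iff)
  }
  {
    assume "P_degenerate N r d \<Gamma>"
    then have path: "path_angle_condition r d {1..N} \<Gamma>"
      and "stratified (P_stratum N r d) r (Sing r {1..N} \<Gamma>)"
      by (simp_all add: P_degenerate_def P_stratified_straight_iff)
    with P_stratified_imp_V_stratified[OF assms(1,2)] obtain \<tau> where
      \<tau>: "straight_tangents (Sing r {1..N} \<Gamma>) \<tau>" "matches_angles r d (Sing r {1..N} \<Gamma>) \<tau>"
        "stratified (V_stratum N r d \<tau>) r (Sing r {1..N} \<Gamma>)"
      by blast
    obtain Q where Q: "\<forall>i. rotation_matrix (Q i)"
      and agree: "agree_at_vertices r (Sing r {1..N} \<Gamma>) Q"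
      and vir: "virtual_angle_condition r d {1..N} \<Gamma>
        (\<lambda>z i. if i \<in> Sing r {1..N} \<Gamma> then Q i *v \<tau> z i else outer_tangent r \<Gamma> z i)"
      using extend_tangents[OF assms(2)[unfolded assigned_angles_def] network_Reg_Sing[OF assms(3)] path \<tau>(2,1)] by (elim exE conjE)
    have "stratified (V_stratum N r d
        (\<lambda>z i. if i \<in> Sing r {1..N} \<Gamma> then Q i *v \<tau> z i else outer_tangent r \<Gamma> z i))
        r (Sing r {1..N} \<Gamma>)"
      by (rule stratified_rotated[OF assms(1) \<tau>(3) Q[rule_format] agree]) auto
    then show "V_degenerate N r d \<Gamma>"
      using vir sub unfolding V_degenerate_def V_stratified_straight_iff by blast
  }
qed

end
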